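(* Let $\alpha\in(0,2)$, $x_0\in\mathbb{R}$, and let $f,g,\sigma:\mathbb{R}\to\mathbb{R}$ satisfy: (H1) there is $\gamma>0$ such that for all $x_1,x_2\in\mathbb{R}$, $|f(x_1)-f(x_2)|^2+|g(x_1)-g(x_2)|^2+\int_{|y|<1}|\sigma(x_1)y-\sigma(x_2)y|^2\,\nu^\alpha(dy)\le\gamma|x_1-x_2|^2$; (H2) there is $K>0$ such that for all $x\in\mathbb{R}$, $2xf(x)+|g(x)|^2+\int_{|y|<1}|\sigma(x)y|^2\,\nu^\alpha(dy)\le K(1+x^2)$; (H3) $|\sigma(\cdot)|^\alpha\in C^1(\mathbb{R})$ and $\sigma(x)\ne0$ for all $x\in\mathbb{R}$. Consider the It\^o stochastic differential equation $$dX_t=f(X_t)\,dt+g(X_t)\,dB_t+\sigma(X_{t-})\,dL^\alpha_t,\qquad X_0=x_0 .$$ Then the Fokker-Planck equation for this SDE is $$\frac{\partial p}{\partial t}=A^*p,\qquad p(x,0)=\delta(x-x_0),$$ where $$A^*p(x,t)=-\partial_x\big(f(x)p(x,t)\big)+\tfrac12\partial_{xx}\big(g^2(x)p(x,t)\big)+\mathrm{P.V.}\int_{\mathbb{R}\setminus\{0\}}\big[|\sigma(x+z)|^\alpha p(x+z,t)-|\sigma(x)|^\alpha p(x,t)\big]\,\nu^\alpha(dz).$$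
   Context: $B$ is a standard one-dimensional Brownian motion. $L^\alpha$ is a one-dimensional symmetric $\alpha$-stable L\'evy process, independent of $B$, with characteristic exponent $-|u|^\alpha$, i.e. generating triplet $(0,0,\nu^\alpha)$ with L\'evy measure $\nu^\alpha(du)=c(1,\alpha)|u|^{-1-\alpha}du$ on $\mathbb{R}\setminus\{0\}$, where $c(1,\alpha)=\dfrac{\alpha\Gamma((1+\alpha)/2)}{2^{1-\alpha}\pi^{1/2}\Gamma(1-\alpha/2)}$. P.V. denotes the Cauchy principal value, i.e. the limit as $\varepsilon\to0$ of the integral over $\{|z|>\varepsilon\}$. The generator of the SDE is $A\varphi(x)=f(x)\varphi'(x)+\frac12g^2(x)\varphi''(x)+\int_{\mathbb{R}\setminus\{0\}}[\varphi(x+\sigma(x)y)-\varphi(x)-\sigma(x)y\varphi'(x)I_{\{|y|<1\}}(y)]\,\nu^\alpha(dy)$. "The Fokker-Planck equation for the SDE" means the evolution equation $\partial_tp=A^*p$ for the probability density $p(x,t)$ of $X_t$ with initial condition $\delta(x-x_0)$, where $A^*$ is the adjoint of $A$ in the Hilbert space $L^2(\mathbb{R})$, i.e. $\int_{\mathbb{R}} A\varphi(x)\,v(x)\,dx=\int_{\mathbb{R}}\varphi(x)\,A^*v(x)\,dx$ for $\varphi$ in the domain of $A$ and $v$ in the domain of $A^*$. The content of the claim is that $A^*$ has the displayed form. *)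

theory Defs
  imports "HOL-Analysis.Analysis"
begin

definition stable_const :: "real \<Rightarrow> real" where
  "stable_const \<alpha> =
     \<alpha> * Gamma ((1 + \<alpha>) / 2) / (2 powr (1 - \<alpha>) * sqrt pi * Gamma (1 - \<alpha> / 2))"

text \<open>
  The density vanishes at the origin (\<open>0 powr a = 0\<close>), so an integral over the whole line
  against this measure is an integral over the line without the origin.
\<close>

definition stable_nu :: "real \<Rightarrow> real measure" where
  "stable_nu \<alpha> = density lborel (\<lambda>u. ennreal (stable_const \<alpha> * \<bar>u\<bar> powr (- 1 - \<alpha>)))"

definition L2 :: "(real \<Rightarrow> real) \<Rightarrow> bool" where
  "L2 v \<longleftrightarrow> v \<in> borel_measurable lborel \<and> integrable lborel (\<lambda>x. (v x)\<^sup>2)"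

definition C2 :: "(real \<Rightarrow> real) \<Rightarrow> bool" where
  "C2 \<phi> \<longleftrightarrow> \<phi> C1_differentiable_on UNIV \<and> deriv \<phi> C1_differentiable_on UNIV"

definition C2c :: "(real \<Rightarrow> real) set" where
  "C2c = {\<phi>. C2 \<phi> \<and> compact (closure {x. \<phi> x \<noteq> 0})}"

text \<open>
  The adjoint in \<open>L\<^sup>2(\<real>)\<close> of the operator \<open>A\<close> with domain \<open>D\<close>, as a graph:
  \<open>L2_adjoint D A v w\<close> says that \<open>v\<close> lies in the domain of the adjoint and that \<open>w\<close>
  is a representative of its image.  It is meant for \<open>A\<close> mapping \<open>D\<close> into square
  integrable functions, which makes all the products below integrable.
\<close>

definition L2_adjoint ::
    "(real \<Rightarrow> real) set \<Rightarrow> ((real \<Rightarrow> real) \<Rightarrow> (real \<Rightarrow> real)) \<Rightarrow> (real \<Rightarrow> real) \<Rightarrow> (real \<Rightarrow> real) \<Rightarrow> bool" where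
  "L2_adjoint D A v w \<longleftrightarrow>
     L2 v \<and> L2 w \<and> (\<forall>\<phi>\<in>D. (LINT x|lborel. A \<phi> x * v x) = (LINT x|lborel. \<phi> x * w x))"

definition L2_adjoint_dom ::
    "(real \<Rightarrow> real) set \<Rightarrow> ((real \<Rightarrow> real) \<Rightarrow> (real \<Rightarrow> real)) \<Rightarrow> (real \<Rightarrow> real) set" where
  "L2_adjoint_dom D A = {v. \<exists>w. L2_adjoint D A v w}"

definition jump_integrand ::
    "(real \<Rightarrow> real) \<Rightarrow> (real \<Rightarrow> real) \<Rightarrow> real \<Rightarrow> real \<Rightarrow> real" where
  "jump_integrand \<sigma> \<phi> x y =
     \<phi> (x + \<sigma> x * y) - \<phi> x - \<sigma> x * y * deriv \<phi> x * indicator {y. \<bar>y\<bar> < 1} y"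

definition generator ::
    "real \<Rightarrow> (real \<Rightarrow> real) \<Rightarrow> (real \<Rightarrow> real) \<Rightarrow> (real \<Rightarrow> real) \<Rightarrow> (real \<Rightarrow> real) \<Rightarrow> real \<Rightarrow> real" where
  "generator \<alpha> f g \<sigma> \<phi> x =
     f x * deriv \<phi> x + 1 / 2 * (g x)\<^sup>2 * deriv (deriv \<phi>) x
     + (LINT y|stable_nu \<alpha>. jump_integrand \<sigma> \<phi> x y)"

text \<open>
  The domains on which the generator acts by its formula as an operator in \<open>L\<^sup>2(\<real>)\<close>;
  they are only required to contain the test functions \<open>C2c\<close>.
\<close>

definition generator_domain ::
    "real \<Rightarrow> (real \<Rightarrow> real) \<Rightarrow> (real \<Rightarrow> real) \<Rightarrow> (real \<Rightarrow> real) \<Rightarrow> (real \<Rightarrow> real) set \<Rightarrow> bool" where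
  "generator_domain \<alpha> f g \<sigma> D \<longleftrightarrow>
     C2c \<subseteq> D \<and>
     (\<forall>\<phi>\<in>D. C2 \<phi> \<and> L2 \<phi> \<and> (\<forall>x. integrable (stable_nu \<alpha>) (jump_integrand \<sigma> \<phi> x)) \<and>
            L2 (generator \<alpha> f g \<sigma> \<phi>))"

definition truncated_jump ::
    "real \<Rightarrow> (real \<Rightarrow> real) \<Rightarrow> (real \<Rightarrow> real) \<Rightarrow> real \<Rightarrow> real \<Rightarrow> real" where
  "truncated_jump \<alpha> \<sigma> v \<epsilon> x =
     (LINT z:{z. \<bar>z\<bar> > \<epsilon>}|stable_nu \<alpha>.
        \<bar>\<sigma> (x + z)\<bar> powr \<alpha> * v (x + z) - \<bar>\<sigma> x\<bar> powr \<alpha> * v x)"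

definition pv_jump :: "real \<Rightarrow> (real \<Rightarrow> real) \<Rightarrow> (real \<Rightarrow> real) \<Rightarrow> real \<Rightarrow> real" where
  "pv_jump \<alpha> \<sigma> v x = Lim (at_right 0) (\<lambda>\<epsilon>. truncated_jump \<alpha> \<sigma> v \<epsilon> x)"

definition fp_operator ::
    "real \<Rightarrow> (real \<Rightarrow> real) \<Rightarrow> (real \<Rightarrow> real) \<Rightarrow> (real \<Rightarrow> real) \<Rightarrow> (real \<Rightarrow> real) \<Rightarrow> real \<Rightarrow> real" where
  "fp_operator \<alpha> f g \<sigma> v x =
     - deriv (\<lambda>x. f x * v x) x + 1 / 2 * deriv (deriv (\<lambda>x. (g x)\<^sup>2 * v x)) x
     + pv_jump \<alpha> \<sigma> v x"

text \<open>
  The functions for which \<open>fp_operator\<close> makes classical sense.  The derivatives are those of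
  the products \<open>f v\<close> and \<open>g\<^sup>2 v\<close>, since the coefficients need not be differentiable, and the
  limit defining the principal value exists locally uniformly in \<open>x\<close>.  The latter holds for
  instance if \<open>\<bar>\<sigma>\<bar> powr \<alpha> * v\<close> is of class \<open>C\<^sup>2\<close>, and for \<open>\<alpha> < 1\<close> if it is of class \<open>C\<^sup>1\<close>.
\<close>

definition fp_regular ::
    "real \<Rightarrow> (real \<Rightarrow> real) \<Rightarrow> (real \<Rightarrow> real) \<Rightarrow> (real \<Rightarrow> real) \<Rightarrow> (real \<Rightarrow> real) \<Rightarrow> bool" where
  "fp_regular \<alpha> f g \<sigma> v \<longleftrightarrow>
     L2 v \<and>
     (\<lambda>x. f x * v x) C1_differentiable_on UNIV \<and>
     C2 (\<lambda>x. (g x)\<^sup>2 * v x) \<and>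
     (\<forall>K. compact K \<longrightarrow> uniform_limit K (truncated_jump \<alpha> \<sigma> v) (pv_jump \<alpha> \<sigma> v) (at_right 0))"

definition fp_classical ::
    "real \<Rightarrow> (real \<Rightarrow> real) \<Rightarrow> (real \<Rightarrow> real) \<Rightarrow> (real \<Rightarrow> real) \<Rightarrow> (real \<Rightarrow> real) \<Rightarrow> (real \<Rightarrow> real) \<Rightarrow> bool" where
  "fp_classical \<alpha> f g \<sigma> v w \<longleftrightarrow>
     L2 v \<and> L2 w \<and> (AE x in lborel. w x = fp_operator \<alpha> f g \<sigma> v x)"

text \<open>
  The same formula for an arbitrary square integrable \<open>v\<close>, with both derivatives and the
  principal value limit taken in the sense of distributions.
\<close>

definition fp_weak ::
    "real \<Rightarrow> (real \<Rightarrow> real) \<Rightarrow> (real \<Rightarrow> real) \<Rightarrow> (real \<Rightarrow> real) \<Rightarrow> (real \<Rightarrow> real) \<Rightarrow> (real \<Rightarrow> real) \<Rightarrow> bool" where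
  "fp_weak \<alpha> f g \<sigma> v w \<longleftrightarrow>
     L2 v \<and> L2 w \<and>
     (\<forall>\<phi>\<in>C2c.
        ((\<lambda>\<epsilon>. (LINT x|lborel. deriv \<phi> x * (f x * v x))
              + 1 / 2 * (LINT x|lborel. deriv (deriv \<phi>) x * ((g x)\<^sup>2 * v x))
              + (LINT x|lborel. \<phi> x * truncated_jump \<alpha> \<sigma> v \<epsilon> x))
           \<longlongrightarrow> (LINT x|lborel. \<phi> x * w x)) (at_right 0))"

text \<open>
  \<open>evolution_problem G x0 p\<close>: the function \<open>p x t\<close> solves \<open>\<partial>\<^sub>t p = G p\<close> for \<open>t > 0\<close>, where the
  operator \<open>G\<close> in \<open>L\<^sup>2(\<real>)\<close> is given by its graph, and \<open>p(\<cdot>, t)\<close> tends vaguely to the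
  Dirac measure at \<open>x0\<close> as \<open>t\<close> tends to zero.
\<close>

definition evolution_problem ::
    "((real \<Rightarrow> real) \<Rightarrow> (real \<Rightarrow> real) \<Rightarrow> bool) \<Rightarrow> real \<Rightarrow> (real \<Rightarrow> real \<Rightarrow> real) \<Rightarrow> bool" where
  "evolution_problem G x0 p \<longleftrightarrow>
     (\<forall>t>0. \<exists>q. (\<forall>x. ((\<lambda>s. p x s) has_real_derivative q x) (at t)) \<and> G (\<lambda>x. p x t) q) \<and>
     (\<forall>\<phi>::real \<Rightarrow> real. continuous_on UNIV \<phi> \<longrightarrow> compact (closure {x. \<phi> x \<noteq> 0}) \<longrightarrow>
        ((\<lambda>t. LINT x|lborel. \<phi> x * p x t) \<longlongrightarrow> \<phi> x0) (at_right 0))"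

end

(* Write k for the Levy density, s = |sigma|^alpha and u = s v. Since k is even, the compensator
   of the jump part of the generator disappears after symmetrization, and scaling the jumps by
   sigma(x) gives s(x) L phi(x), where L phi(x) is half the integral of the second difference
   phi(x+z) + phi(x-z) - 2 phi(x) against k. The Lipschitz bound on sigma makes s grow at most like
   |x|^alpha, while the second differences of a test function integrate to O(|x|^(-1-alpha)); the
   product is O(1/|x|), hence square integrable, which is what makes u L phi integrable for every
   v in L^2. Cutting the jumps off at eps, Fubini and the symmetry of k move the truncated operator
   from phi onto u, and dominated convergence lets eps tend to 0. This identifies the weak
   Fokker-Planck formula with the adjoint of the generator restricted to test functions. For
   regular v one integrates by parts and uses the locally uniform limit. The fundamental lemma of
   the calculus of variations shows that test functions determine the image of v, which passes from
   C2c to an arbitrary domain D. *)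

theory Submission
  imports Defs
begin

section \<open>The jump kernel\<close>

text \<open>The weighted function s v need not be square integrable. What it has is integrability
  against (1+|y|)^(-1-\<alpha>), and this is the decay of the jump kernel seen from a bounded set.
  Both limit arguments see s v only through this weight: Fubini for a fixed cutoff, and dominated
  convergence as the cutoff vanishes, where the majorant must not depend on the cutoff. Second
  differences supply such a majorant because they converge absolutely against the kernel; first
  differences in general do not when \<alpha> \<ge> 1. Consequently the limit in the weak formula
  exists for every v in L^2, with the pairing of the generator as its value, and the comparison with
  the adjoint reduces to uniqueness of limits. Enlarging D imposes more conditions on a pair (v, w),
  so the domain of the adjoint may shrink. Hence the equivalences for D are restricted to v in that
  domain, while the domain itself is characterized for the test functions.\<close>

lemma integrable_even_lborel:
  fixes h :: "real \<Rightarrow> real"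
  assumes [measurable]: "h \<in> borel_measurable borel"
    and nonneg: "\<And>z. 0 \<le> h z" and even: "\<And>z. h (- z) = h z" and "h 0 = 0"
    and I: "(h has_integral I) {0..}"
  shows "integrable lborel h"
proof -
  let ?g = "\<lambda>z. if z \<in> {0..} then h z else 0"
  have "(?g has_integral I) UNIV"
    using I by (simp only: has_integral_restrict_UNIV)
  then have "(\<integral>\<^sup>+x. ennreal (?g x) \<partial>lborel) = ennreal I"
    by (intro nn_integral_has_integral_lborel) (auto simp: nonneg)
  then have g: "integrable lborel ?g"
    by (intro integrableI_nonneg) (auto simp: nonneg)
  have "integrable lborel (\<lambda>z. ?g (0 + (-1) * z))"
    using g by (subst lborel_integrable_real_affine_iff) auto
  \<comment> \<open>Away from the origin this sum is h z, but at the origin it is 2 h 0; hence the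
    assumption \<open>h 0 = 0\<close>.\<close>
  then have "integrable lborel (\<lambda>z. ?g z + ?g (- z))"
    by (intro Bochner_Integration.integrable_add g) (simp cong: if_cong)
  then show ?thesis
    by (rule back_subst[where P = "integrable lborel"]) (auto simp: even \<open>h 0 = 0\<close>)
qed

definition stable_kernel :: "real \<Rightarrow> real \<Rightarrow> real" where
  "stable_kernel \<alpha> z = stable_const \<alpha> * \<bar>z\<bar> powr (- 1 - \<alpha>)"

lemma stable_const_pos: "0 < \<alpha> \<Longrightarrow> \<alpha> < 2 \<Longrightarrow> 0 < stable_const \<alpha>"
  unfolding stable_const_def by (intro divide_pos_pos mult_pos_pos Gamma_real_pos) auto

lemma stable_kernel_nonneg: "0 < \<alpha> \<Longrightarrow> \<alpha> < 2 \<Longrightarrow> 0 \<le> stable_kernel \<alpha> z"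
  unfolding stable_kernel_def using stable_const_pos[of \<alpha>] by simp

lemma stable_kernel_minus [simp]: "stable_kernel \<alpha> (- z) = stable_kernel \<alpha> z"
  by (simp add: stable_kernel_def)

lemma stable_kernel_measurable [measurable]: "stable_kernel \<alpha> \<in> borel_measurable borel"
  unfolding stable_kernel_def by measurable

text \<open>Homogeneity of degree -1-\<alpha>. The Jacobian of the substitution z = s y removes one
  factor |s|, so the exponent 1+\<alpha> found here ends up as the weight |s|^\<alpha> of the
  Fokker-Planck operator.\<close>

lemma stable_kernel_scale:
  "s \<noteq> 0 \<Longrightarrow> stable_kernel \<alpha> z = \<bar>s\<bar> powr (1 + \<alpha>) * stable_kernel \<alpha> (s * z)"
proof -
  assume "s \<noteq> 0"
  then have "\<bar>s\<bar> powr (1 + \<alpha>) * \<bar>s\<bar> powr (- 1 - \<alpha>) = 1"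
    by (simp flip: powr_add)
  then show ?thesis
    by (simp add: stable_kernel_def abs_mult powr_mult)
qed

lemma stable_nu_density:
  "stable_nu \<alpha> = density lborel (\<lambda>u. ennreal (stable_kernel \<alpha> u))"
  by (simp add: stable_nu_def stable_kernel_def)

lemma
  assumes "0 < \<alpha>" "\<alpha> < 2" and [measurable]: "h \<in> borel_measurable borel"
  shows integral_stable_nu: "(LINT y|stable_nu \<alpha>. h y) = (LINT y|lborel. stable_kernel \<alpha> y * (h y :: real))"
    and integrable_stable_nu: "integrable (stable_nu \<alpha>) h \<longleftrightarrow> integrable lborel (\<lambda>y. stable_kernel \<alpha> y * h y)"
  unfolding stable_nu_density using assms
  by (simp_all add: integral_density integrable_density stable_kernel_nonneg)

text \<open>The exponent -1-\<alpha> lies below -1 because \<alpha> is positive.\<close>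

lemma integrable_stable_kernel_tail:
  assumes "0 < \<alpha>" "\<alpha> < 2" "0 < \<epsilon>"
  shows "integrable lborel (\<lambda>z. indicator {z. \<epsilon> < \<bar>z\<bar>} z * stable_kernel \<alpha> z)"
proof -
  have "((\<lambda>z. if z \<in> {\<epsilon>..} then z powr (- 1 - \<alpha>) else 0)
      has_integral - (\<epsilon> powr (- 1 - \<alpha> + 1)) / (- 1 - \<alpha> + 1)) {0..}"
    using has_integral_powr_to_inf[of "- 1 - \<alpha>" \<epsilon>] assms
    by (subst has_integral_restrict) auto
  then have "integrable lborel (\<lambda>z. indicator {z. \<epsilon> \<le> \<bar>z\<bar>} z * \<bar>z\<bar> powr (- 1 - \<alpha>))"
    by (intro integrable_even_lborel) (auto elim!: has_integral_eq[rotated] simp: \<open>0 < \<epsilon>\<close> indicator_def)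
  then have "integrable lborel (\<lambda>z. stable_const \<alpha> * (indicator {z. \<epsilon> \<le> \<bar>z\<bar>} z * \<bar>z\<bar> powr (- 1 - \<alpha>)))"
    by (rule integrable_mult_right)
  then show ?thesis
    by (rule Bochner_Integration.integrable_bound)
       (auto simp: stable_kernel_def indicator_def abs_mult)
qed

text \<open>The integrand is a multiple of |z|^(1-\<alpha>), and 1-\<alpha> > -1 because \<alpha> <
  2.\<close>

lemma integrable_stable_kernel_near_0:
  assumes "0 < \<alpha>" "\<alpha> < 2"
  shows "integrable lborel (\<lambda>z. indicator {z. \<bar>z\<bar> \<le> 1} z * (z\<^sup>2 * stable_kernel \<alpha> z))"
proof -
  have "((\<lambda>z. if z \<in> {0..1} then z powr (1 - \<alpha>) else 0)
      has_integral 1 powr (1 - \<alpha> + 1) / (1 - \<alpha> + 1)) {0..}"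
    using has_integral_powr_from_0[of "1 - \<alpha>" 1] assms
    by (subst has_integral_restrict) auto
  then have "integrable lborel (\<lambda>z. indicator {z. \<bar>z\<bar> \<le> 1} z * \<bar>z\<bar> powr (1 - \<alpha>))"
    by (intro integrable_even_lborel) (auto elim!: has_integral_eq[rotated] simp: indicator_def)
  then have "integrable lborel (\<lambda>z. stable_const \<alpha> * (indicator {z. \<bar>z\<bar> \<le> 1} z * \<bar>z\<bar> powr (1 - \<alpha>)))"
    by (rule integrable_mult_right)
  moreover have "z\<^sup>2 * \<bar>z\<bar> powr (- 1 - \<alpha>) = \<bar>z\<bar> powr (1 - \<alpha>)" for z :: real
  proof (cases "z = 0")
    case False
    then have "z\<^sup>2 * \<bar>z\<bar> powr (- 1 - \<alpha>) = \<bar>z\<bar> powr 2 * \<bar>z\<bar> powr (- 1 - \<alpha>)"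
      by simp
    also have "\<dots> = \<bar>z\<bar> powr (1 - \<alpha>)"
      by (subst powr_add[symmetric]) simp
    finally show ?thesis .
  qed simp
  ultimately show ?thesis
    by (auto simp: stable_kernel_def mult_ac)
qed

text \<open>Up to a constant, min 1 (z^2) bounds every second difference of a test function,
  uniformly in the base point.\<close>

lemma integrable_min_stable_kernel:
  assumes "0 < \<alpha>" "\<alpha> < 2"
  shows "integrable lborel (\<lambda>z. min 1 (z\<^sup>2) * stable_kernel \<alpha> z)"
proof -
  have "min 1 (z\<^sup>2) = indicator {z. \<bar>z\<bar> \<le> 1} z * z\<^sup>2 + indicator {z. 1 < \<bar>z\<bar>} z" for z :: real
    using abs_square_le_1[of z] by (auto simp: indicator_def min_def)
  then show ?thesis
    using Bochner_Integration.integrable_add[OF integrable_stable_kernel_near_0[OF assms]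
      integrable_stable_kernel_tail[OF assms zero_less_one]]
    by (simp add: algebra_simps)
qed

text \<open>The jump term of \<open>H1\<close> is (\<sigma> x1 - \<sigma> x2)^2 times this moment;
  its positivity turns that term into a Lipschitz bound on \<sigma>.\<close>

lemma stable_nu_second_moment_pos:
  assumes "0 < \<alpha>" "\<alpha> < 2"
  shows "0 < (LINT y:{y. \<bar>y\<bar> < 1}|stable_nu \<alpha>. y\<^sup>2)"
proof -
  let ?J = "\<lambda>z. indicator {z. \<bar>z\<bar> < 1} z * (z\<^sup>2 * stable_kernel \<alpha> z)"
  note c = stable_const_pos[OF assms] and k = stable_kernel_nonneg[OF assms]
  \<comment> \<open>Without integrability the Bochner integral would default to 0 and could not be
    positive.\<close>
  have int: "integrable lborel ?J"
    by (rule Bochner_Integration.integrable_bound[OF integrable_stable_kernel_near_0[OF assms]])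
       (auto simp: indicator_def)
  \<comment> \<open>On (1/2, 1) the power of |z| is at least 1 and z^2 is at least 1/4.\<close>
  have le: "indicator {1/2<..<1} z * (stable_const \<alpha> / 4) \<le> ?J z" for z
  proof (cases "z \<in> {1/2<..<1}")
    case True
    then have "1 \<le> \<bar>z\<bar> powr (- 1 - \<alpha>)"
      using assms True powr_mono2'[of "- 1 - \<alpha>" z 1] by simp
    moreover have "1 / 4 \<le> z\<^sup>2"
      using True power_mono[of "1/2" z 2] by (simp add: power_divide)
    ultimately have "1 / 4 * 1 \<le> z\<^sup>2 * \<bar>z\<bar> powr (- 1 - \<alpha>)"
      by (intro mult_mono) auto
    then have "stable_const \<alpha> * (1 / 4 * 1) \<le> stable_const \<alpha> * (z\<^sup>2 * \<bar>z\<bar> powr (- 1 - \<alpha>))"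
      using c by (intro mult_left_mono) auto
    then show ?thesis
      using True by (auto simp: stable_kernel_def mult_ac)
  qed (simp add: k)
  have "0 < (LINT z|lborel. indicator {1/2<..<1::real} z * (stable_const \<alpha> / 4))"
    using c by simp
  also have "\<dots> \<le> (LINT z|lborel. ?J z)"
    by (intro integral_mono int le integrable_mult_left integrable_real_indicator emeasure_bounded_finite) auto
  also have "\<dots> = (LINT y:{y. \<bar>y\<bar> < 1}|stable_nu \<alpha>. y\<^sup>2)"
    unfolding set_lebesgue_integral_def
    by (subst integral_stable_nu[OF assms]) (auto simp: mult_ac)
  finally show ?thesis .
qed

text \<open>Applied to the jump integrand, this removes the first-order compensator, which is odd in the
  jump size.\<close>

lemma stable_kernel_symmetrize:
  assumes "integrable lborel (\<lambda>z. stable_kernel \<alpha> z * H z)"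
  shows "integrable lborel (\<lambda>z. stable_kernel \<alpha> z * (H z + H (- z)))"
    and "(LINT z|lborel. stable_kernel \<alpha> z * H z)
      = 1 / 2 * (LINT z|lborel. stable_kernel \<alpha> z * (H z + H (- z)))"
proof -
  have "integrable lborel (\<lambda>z. stable_kernel \<alpha> (0 + (-1) * z) * H (0 + (-1) * z))"
    using assms by (subst lborel_integrable_real_affine_iff) auto
  then have minus: "integrable lborel (\<lambda>z. stable_kernel \<alpha> z * H (- z))"
    by simp
  show "integrable lborel (\<lambda>z. stable_kernel \<alpha> z * (H z + H (- z)))"
    using Bochner_Integration.integrable_add[OF assms minus] by (simp add: algebra_simps)
  have "(LINT z|lborel. stable_kernel \<alpha> z * H z) = (LINT z|lborel. stable_kernel \<alpha> z * H (- z))"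
    by (subst lborel_integral_real_affine[where c = "-1" and t = 0]) auto
  then show "(LINT z|lborel. stable_kernel \<alpha> z * H z)
      = 1 / 2 * (LINT z|lborel. stable_kernel \<alpha> z * (H z + H (- z)))"
    using assms minus by (simp add: ring_distribs)
qed

section \<open>Test functions\<close>

lemma C1_differentiable_on_UNIV_D:
  fixes h :: "real \<Rightarrow> real"
  assumes "h C1_differentiable_on UNIV"
  shows "(h has_real_derivative deriv h x) (at x)" and "continuous_on UNIV (deriv h)"
proof -
  obtain D where D: "\<And>x. (h has_real_derivative D x) (at x)" "continuous_on UNIV D"
    using assms
    by (auto simp: C1_differentiable_on_def has_real_derivative_iff_has_vector_derivative)
  have "deriv h = D"
    using D(1) by (auto intro: DERIV_imp_deriv)
  with D show "(h has_real_derivative deriv h x) (at x)" "continuous_on UNIV (deriv h)"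
    by auto
qed

lemma C1_differentiable_on_UNIV_I:
  fixes h :: "real \<Rightarrow> real"
  assumes "\<And>x. (h has_real_derivative D x) (at x)" "continuous_on UNIV D"
  shows "h C1_differentiable_on UNIV"
  using assms by (auto simp: C1_differentiable_on_def has_real_derivative_iff_has_vector_derivative)

lemma C1_differentiable_on_UNIV_continuous:
  fixes h :: "real \<Rightarrow> real"
  shows "h C1_differentiable_on UNIV \<Longrightarrow> continuous_on UNIV h"
  using C1_differentiable_on_UNIV_D(1) DERIV_isCont
  by (blast intro: continuous_at_imp_continuous_on)

lemma C2_I:
  assumes "\<And>x. (\<phi> has_real_derivative D x) (at x)" "\<And>x. (D has_real_derivative E x) (at x)"
    and "continuous_on UNIV E"
  shows "C2 \<phi>"
proof -
  have "deriv \<phi> = D"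
    using assms(1) by (auto intro: DERIV_imp_deriv)
  moreover have "continuous_on UNIV D"
    using assms(2) DERIV_isCont by (blast intro: continuous_at_imp_continuous_on)
  ultimately show ?thesis
    using assms by (auto simp: C2_def intro: C1_differentiable_on_UNIV_I)
qed

lemma C2_D:
  assumes "C2 \<phi>"
  shows "(\<phi> has_real_derivative deriv \<phi> x) (at x)"
    and "(deriv \<phi> has_real_derivative deriv (deriv \<phi>) x) (at x)"
    and "continuous_on UNIV \<phi>" "continuous_on UNIV (deriv \<phi>)"
    and "continuous_on UNIV (deriv (deriv \<phi>))"
  using assms unfolding C2_def
  by (auto intro: C1_differentiable_on_UNIV_D C1_differentiable_on_UNIV_continuous)

text \<open>Compact support with an explicit radius. The strict inequality makes the exterior open,
  so derivatives vanish on the same exterior.\<close>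

definition vanishes_off :: "real \<Rightarrow> (real \<Rightarrow> real) \<Rightarrow> bool" where
  "vanishes_off R h \<longleftrightarrow> (\<forall>x. R < \<bar>x\<bar> \<longrightarrow> h x = 0)"

lemma deriv_vanishes_off:
  assumes "vanishes_off R h"
  shows "vanishes_off R (deriv h)"
  unfolding vanishes_off_def
proof (intro allI impI)
  fix x :: real assume x: "R < \<bar>x\<bar>"
  have "((\<lambda>_. 0) has_field_derivative 0) (at x)"
    by simp
  moreover have "open {x::real. R < \<bar>x\<bar>}"
    by (intro open_Collect_less continuous_intros)
  ultimately have "(h has_field_derivative 0) (at x)"
    by (rule has_field_derivative_transform_within_open)
       (use x assms in \<open>auto simp: vanishes_off_def\<close>)
  then show "deriv h x = 0"
    by (rule DERIV_imp_deriv)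
qed

lemma C2c_vanishes_off:
  assumes "\<phi> \<in> C2c"
  obtains R where "1 \<le> R" "vanishes_off R \<phi>" "vanishes_off R (deriv \<phi>)"
    "vanishes_off R (deriv (deriv \<phi>))"
proof -
  have "bounded {x. \<phi> x \<noteq> 0}"
    using assms by (auto simp: C2c_def intro: bounded_subset[OF compact_imp_bounded closure_subset])
  then obtain B where "\<forall>x. \<phi> x \<noteq> 0 \<longrightarrow> \<bar>x\<bar> \<le> B"
    by (auto simp: bounded_iff)
  \<comment> \<open>A radius of at least 1 is positive and can later serve as a cutoff level for the
    kernel.\<close>
  then have "vanishes_off (max 1 B) \<phi>"
    by (force simp: vanishes_off_def)
  then show ?thesis
    by (intro that[of "max 1 B"] deriv_vanishes_off) auto
qed

lemma continuous_vanishes_off_bounded: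
  assumes "continuous_on UNIV h" "vanishes_off R h"
  obtains M where "0 \<le> M" "\<And>x. \<bar>h x\<bar> \<le> M"
proof -
  have "bounded (h ` {- R..R})"
    by (intro compact_imp_bounded compact_continuous_image continuous_on_subset[OF assms(1)]) auto
  then obtain B where "\<forall>y\<in>h ` {- R..R}. norm y \<le> B"
    unfolding bounded_iff by blast
  then have B: "\<And>x. x \<in> {- R..R} \<Longrightarrow> \<bar>h x\<bar> \<le> B"
    by auto
  \<comment> \<open>For R < 0 the interval is empty and B may be negative.\<close>
  have "\<bar>h x\<bar> \<le> max 0 B" for x
    using B[of x] assms(2)[unfolded vanishes_off_def, rule_format, of x]
    by (cases "R < \<bar>x\<bar>") (simp_all add: abs_le_iff[of x] not_less le_max_iff_disj)
  then show ?thesis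
    by (intro that[of "max 0 B"]) auto
qed

definition loc_integrable :: "(real \<Rightarrow> real) \<Rightarrow> bool" where
  "loc_integrable u \<longleftrightarrow> (\<forall>R. integrable lborel (\<lambda>x. indicator {- R..R} x * u x))"

lemma loc_integrable_continuous: "continuous_on UNIV u \<Longrightarrow> loc_integrable u"
  unfolding loc_integrable_def
  using borel_integrable_compact[OF compact_Icc continuous_on_subset[of UNIV u]] by auto

lemma loc_integrable_add: "loc_integrable u \<Longrightarrow> loc_integrable v \<Longrightarrow> loc_integrable (\<lambda>x. u x + v x)"
  by (simp add: loc_integrable_def ring_distribs)

lemma loc_integrable_diff: "loc_integrable u \<Longrightarrow> loc_integrable v \<Longrightarrow> loc_integrable (\<lambda>x. u x - v x)"
  by (simp add: loc_integrable_def ring_distribs)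

lemma L2_imp_loc_integrable:
  assumes "L2 v"
  shows "loc_integrable v"
  unfolding loc_integrable_def
proof
  fix R
  have [measurable]: "v \<in> borel_measurable borel" and v: "integrable lborel (\<lambda>x. (v x)\<^sup>2)"
    using assms by (auto simp: L2_def)
  have "integrable lborel (\<lambda>x. indicator {- R..R} x + (v x)\<^sup>2)"
    using v by (intro Bochner_Integration.integrable_add integrable_real_indicator
      emeasure_bounded_finite) auto
  then show "integrable lborel (\<lambda>x. indicator {- R..R} x * v x)"
  proof (rule Bochner_Integration.integrable_bound)
    have "\<bar>t\<bar> \<le> 1 + t\<^sup>2" for t :: real
      using sum_squares_ge_zero[of "\<bar>t\<bar> - 1" 0] by (simp add: power2_eq_square algebra_simps)
    then show "AE x in lborel. norm (indicator {- R..R} x * v x)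
        \<le> norm (indicator {- R..R} x + (v x)\<^sup>2)"
      by (auto simp: indicator_def)
  qed auto
qed

lemma integrable_vanishes_off_mult:
  assumes "continuous_on UNIV h" "vanishes_off R h" "loc_integrable u"
  shows "integrable lborel (\<lambda>x. h x * u x)"
proof -
  have [measurable]: "h \<in> borel_measurable borel"
    using assms(1) by (rule borel_measurable_continuous_onI)
  obtain M where M: "0 \<le> M" "\<And>x. \<bar>h x\<bar> \<le> M"
    using continuous_vanishes_off_bounded[OF assms(1,2)] by metis
  have u: "integrable lborel (\<lambda>x. indicator {- R..R} x * u x)"
    using assms(3) by (simp add: loc_integrable_def)
  have eq: "h x * u x = h x * (indicator {- R..R} x * u x)" for x
    using assms(2) by (cases "R < \<bar>x\<bar>") (auto simp: vanishes_off_def indicator_def)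
  show ?thesis
    unfolding eq
  proof (rule Bochner_Integration.integrable_bound[OF integrable_mult_right[OF u, of M]])
    show "(\<lambda>x. h x * (indicator {- R..R} x * u x)) \<in> borel_measurable lborel"
      using borel_measurable_integrable[OF u] by simp
    show "AE x in lborel. norm (h x * (indicator {- R..R} x * u x))
        \<le> norm (M * (indicator {- R..R} x * u x))"
      using M by (auto simp: abs_mult intro!: mult_right_mono)
  qed
qed

text \<open>The mean value theorem applies to the even function t -> \<phi>(x+t) + \<phi>(x-t) on
  [0, z], and then to the derivative of \<phi> on [x-t, x+t]. That interval has length 2t < 2z,
  which accounts for the factor 2; it is not optimal, but only the order z^2 matters.\<close>

lemma second_difference_bound:
  assumes "C2 \<phi>" "\<And>x. \<bar>deriv (deriv \<phi>) x\<bar> \<le> M"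
  shows "\<bar>\<phi> (x + z) + \<phi> (x - z) - 2 * \<phi> x\<bar> \<le> 2 * M * z\<^sup>2"
proof -
  have pos: "\<bar>\<phi> (x + z) + \<phi> (x - z) - 2 * \<phi> x\<bar> \<le> 2 * M * z\<^sup>2" if "0 < z" for z
  proof -
    have "\<exists>t>0. t < z \<and> \<phi> (x + z) + \<phi> (x - z) - (\<phi> (x + 0) + \<phi> (x - 0))
        = (z - 0) * (deriv \<phi> (x + t) - deriv \<phi> (x - t))"
      using \<open>0 < z\<close>
      by (intro MVT2) (auto intro!: derivative_eq_intros DERIV_chain2[OF C2_D(1)[OF assms(1)]])
    then obtain t where t: "0 < t" "t < z"
      and *: "\<phi> (x + z) + \<phi> (x - z) - 2 * \<phi> x = z * (deriv \<phi> (x + t) - deriv \<phi> (x - t))"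
      by auto
    have "\<exists>y>x - t. y < x + t \<and> deriv \<phi> (x + t) - deriv \<phi> (x - t)
        = (x + t - (x - t)) * deriv (deriv \<phi>) y"
      using t by (intro MVT2 C2_D(2)[OF assms(1)]) auto
    then obtain y where "deriv \<phi> (x + t) - deriv \<phi> (x - t) = 2 * t * deriv (deriv \<phi>) y"
      by auto
    with * have "\<bar>\<phi> (x + z) + \<phi> (x - z) - 2 * \<phi> x\<bar> = z * (2 * t * \<bar>deriv (deriv \<phi>) y\<bar>)"
      using t by (simp add: abs_mult)
    also have "\<dots> \<le> z * (2 * z * M)"
      using t assms(2)[of y] by (intro mult_mono) (auto intro: mult_nonneg_nonneg)
    finally show ?thesis
      by (simp add: power2_eq_square mult_ac)
  qed
  show ?thesis
    using pos[of z] pos[of "- z"] by (cases z "0::real" rule: linorder_cases) (auto simp: add.commute)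
qed

text \<open>The exponent is at least 2, so the difference quotient at the kink is a positive power
  of max 0 h and tends to 0.\<close>

lemma DERIV_max_0_power:
  "((\<lambda>t. max 0 t ^ (n + 2)) has_real_derivative real (n + 2) * max 0 t ^ (n + 1)) (at t)"
proof (cases t "0::real" rule: linorder_cases)
  case less
  have "((\<lambda>_. 0) has_real_derivative 0) (at t)"
    by simp
  then have "((\<lambda>t. max 0 t ^ (n + 2)) has_real_derivative 0) (at t)"
    by (rule has_field_derivative_transform_within_open[where S = "{..<0}"]) (use less in auto)
  with less show ?thesis by simp
next
  case equal
  have "(\<lambda>h::real. max 0 h ^ (n + 1)) \<midarrow>0\<rightarrow> max 0 0 ^ (n + 1)"
    by (intro tendsto_intros)
  then have "(\<lambda>h::real. (max 0 (0 + h) ^ (n + 2) - max 0 0 ^ (n + 2)) / h) \<midarrow>0\<rightarrow> 0"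
    by (subst LIM_equal[where g = "\<lambda>h. max 0 h ^ (n + 1)"]) (auto simp: max_def)
  with equal show ?thesis
    by (simp add: DERIV_def)
next
  case greater
  have "((\<lambda>t. t ^ (n + 2)) has_real_derivative real (n + 2) * t ^ (n + 1)) (at t)"
    by (rule derivative_eq_intros refl)+ simp
  then have "((\<lambda>t. max 0 t ^ (n + 2)) has_real_derivative real (n + 2) * t ^ (n + 1)) (at t)"
    by (rule has_field_derivative_transform_within_open[where S = "{0<..}"]) (use greater in auto)
  with greater show ?thesis by simp
qed

text \<open>The third power of a positive part is the lowest integer power of class C^2. The
  quotient takes values in [0, 1) and tends to the indicator of {x. Q x > 0} as c decreases to 0,
  which gives an approximation of intervals by test functions without mollifiers.\<close>

lemma C2c_bump:
  fixes a b c :: real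
  assumes "0 < c"
  defines "Q \<equiv> \<lambda>x. max 0 ((x - a) * (b - x)) ^ 3"
  shows "(\<lambda>x. Q x / (Q x + c)) \<in> C2c"
proof -
  define P where "P = (\<lambda>x. (x - a) * (b - x))"
  define Q1 where "Q1 = (\<lambda>x. 3 * max 0 (P x) ^ 2 * (a + b - 2 * x))"
  define Q2 where "Q2 = (\<lambda>x. 6 * max 0 (P x) * (a + b - 2 * x)\<^sup>2 - 6 * max 0 (P x) ^ 2)"
  have P [derivative_intros]: "(P has_real_derivative (a + b - 2 * x)) (at x)" for x
    unfolding P_def by (auto intro!: derivative_eq_intros)
  have q3: "((\<lambda>t. max 0 t ^ 3) has_real_derivative 3 * max 0 t ^ 2) (at t)" for t :: real
    using DERIV_max_0_power[of 1 t] by (simp add: numeral_3_eq_3 numeral_2_eq_2)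
  have q2: "((\<lambda>t. max 0 t ^ 2) has_real_derivative 2 * max 0 t) (at t)" for t :: real
    using DERIV_max_0_power[of 0 t] by (simp add: numeral_2_eq_2)
  have Q: "(Q has_real_derivative Q1 x) (at x)" for x
    unfolding Q_def Q1_def using DERIV_chain2[OF q3 P] by (simp add: P_def)
  have lin: "((\<lambda>x. a + b - 2 * x) has_real_derivative - 2) (at x)" for x
    by (auto intro!: derivative_eq_intros)
  have Q1: "(Q1 has_real_derivative Q2 x) (at x)" for x
    unfolding Q1_def Q2_def
    by (rule DERIV_cong[OF DERIV_mult[OF DERIV_cmult[OF DERIV_chain2[OF q2 P]] lin]])
       (simp add: power2_eq_square algebra_simps)
  have pos: "0 < Q x + c" for x
    using assms by (auto simp: Q_def intro: add_nonneg_pos)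
  have nz: "Q x + c \<noteq> 0" for x
    using pos[of x] by simp
  have "C2 (\<lambda>x. Q x / (Q x + c))"
  proof (rule C2_I)
    show "((\<lambda>x. Q x / (Q x + c)) has_real_derivative c * Q1 x / (Q x + c)\<^sup>2) (at x)" for x
      using nz[of x] by (auto intro!: derivative_eq_intros Q simp: power2_eq_square algebra_simps)
    show "((\<lambda>x. c * Q1 x / (Q x + c)\<^sup>2) has_real_derivative
        (c * Q2 x * (Q x + c)\<^sup>2 - c * Q1 x * (2 * (Q x + c) * Q1 x)) / ((Q x + c)\<^sup>2 * (Q x + c)\<^sup>2)) (at x)" for x
      using nz[of x] by (auto intro!: derivative_eq_intros Q Q1)
    show "continuous_on UNIV (\<lambda>x. (c * Q2 x * (Q x + c)\<^sup>2 - c * Q1 x * (2 * (Q x + c) * Q1 x))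
        / ((Q x + c)\<^sup>2 * (Q x + c)\<^sup>2))"
      using nz unfolding Q_def Q1_def Q2_def P_def by (intro continuous_intros) auto
  qed
  moreover have "compact (closure {x. Q x / (Q x + c) \<noteq> 0})"
  proof -
    \<comment> \<open>No order between a and b is assumed: for b < a the product is positive on (b,
      a), hence the minimum and maximum.\<close>
    have Q0: "Q x = 0" if "\<not> (min a b \<le> x \<and> x \<le> max a b)" for x
      using that mult_le_0_iff[of "x - a" "b - x"] by (auto simp: Q_def)
    have "min a b \<le> x \<and> x \<le> max a b" if "Q x / (Q x + c) \<noteq> 0" for x
      using that Q0[of x] by (cases "min a b \<le> x \<and> x \<le> max a b") simp_all
    then have "{x. Q x / (Q x + c) \<noteq> 0} \<subseteq> {min a b..max a b}"
      by (simp add: subset_iff)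
    then show ?thesis
      by (metis bounded_closed_interval bounded_subset compact_closure)
  qed
  ultimately show ?thesis
    by (simp add: C2c_def)
qed

section \<open>Fundamental lemma of the calculus of variations\<close>

text \<open>The bumps with c = 1/(n+1) converge pointwise to the indicator of (a, b), are bounded by
  1 and vanish outside that interval, so dominated convergence passes from test functions to
  intervals.\<close>

lemma interval_integral_eq_0_of_test_integrals:
  assumes [measurable]: "u \<in> borel_measurable borel" and u: "loc_integrable u"
    and 0: "\<And>\<phi>. \<phi> \<in> C2c \<Longrightarrow> (LINT x|lborel. \<phi> x * u x) = 0"
  shows "(LINT x|lborel. indicator {a<..<b} x * u x) = 0"
proof (cases "a < b")
  case True
  define Q where "Q = (\<lambda>x. max 0 ((x - a) * (b - x)) ^ 3)"
  define \<phi> where "\<phi> = (\<lambda>n x. Q x / (Q x + inverse (real (Suc n))))"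
  have Q: "0 \<le> Q x" "Q x \<noteq> 0 \<longleftrightarrow> x \<in> {a<..<b}" for x
    using True zero_less_mult_iff[of "x - a" "b - x"] by (auto simp: Q_def max_def)
  have [measurable]: "Q \<in> borel_measurable borel"
    unfolding Q_def by measurable
  define R where "R = max \<bar>a\<bar> \<bar>b\<bar>"
  have "(\<lambda>n. LINT x|lborel. \<phi> n x * u x) \<longlonglongrightarrow> (LINT x|lborel. indicator {a<..<b} x * u x)"
  proof (rule integral_dominated_convergence)
    show "integrable lborel (\<lambda>x. norm (indicator {- R..R} x * u x))"
      using u by (intro integrable_norm) (simp add: loc_integrable_def)
    show "AE x in lborel. (\<lambda>n. \<phi> n x * u x) \<longlonglongrightarrow> indicator {a<..<b} x * u x"
    proof (intro AE_I2 tendsto_mult tendsto_const)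
      fix x
      show "(\<lambda>n. \<phi> n x) \<longlonglongrightarrow> indicator {a<..<b} x"
      proof (cases "Q x = 0")
        case False
        then have "(\<lambda>n. Q x / (Q x + inverse (real (Suc n)))) \<longlonglongrightarrow> Q x / (Q x + 0)"
          by (intro tendsto_intros LIMSEQ_inverse_real_of_nat) auto
        with False Q(2)[of x] show ?thesis
          by (simp add: \<phi>_def)
      qed (use Q(2)[of x] in \<open>simp add: \<phi>_def\<close>)
    qed
    show "AE x in lborel. norm (\<phi> n x * u x) \<le> norm (indicator {- R..R} x * u x)" for n
    proof (intro AE_I2)
      fix x
      have "\<bar>\<phi> n x\<bar> \<le> 1"
        using Q(1)[of x] by (simp add: \<phi>_def divide_simps add_nonneg_pos)
      moreover have "x \<in> {- R..R}" if "\<phi> n x \<noteq> 0"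
        using that Q(2)[of x] by (auto simp: \<phi>_def R_def)
      ultimately show "norm (\<phi> n x * u x) \<le> norm (indicator {- R..R} x * u x)"
        by (cases "\<phi> n x = 0") (auto simp: abs_mult intro: mult_left_le_one_le)
    qed
  qed (auto simp: \<phi>_def)
  moreover have "\<phi> n \<in> C2c" for n
    unfolding \<phi>_def Q_def by (rule C2c_bump) simp
  ultimately show ?thesis
    by (simp add: 0 LIMSEQ_const_iff)
qed simp

text \<open>The positive and negative parts of u, cut off to (-N, N), are densities of two finite
  measures. Vanishing interval integrals make these measures agree on all half-lines (a,
  \<infinity>), hence everywhere, and uniqueness of densities makes the two parts equal almost
  everywhere.\<close>

lemma AE_eq_0_of_test_integrals:
  assumes [measurable]: "u \<in> borel_measurable borel" and u: "loc_integrable u"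
    and 0: "\<And>\<phi>. \<phi> \<in> C2c \<Longrightarrow> (LINT x|lborel. \<phi> x * u x) = 0"
  shows "AE x in lborel. u x = 0"
proof -
  have "AE x in lborel. x \<in> {- real N<..<real N} \<longrightarrow> u x = 0" for N
  proof -
    define w where "w = (\<lambda>x. indicator {- real N<..<real N} x * u x)"
    have [measurable]: "w \<in> borel_measurable borel"
      unfolding w_def by measurable
    have int: "integrable lborel (\<lambda>x. indicator A x * w x)" if [measurable]: "A \<in> sets borel" for A
    proof (rule Bochner_Integration.integrable_bound)
      show "integrable lborel (\<lambda>x. indicator {- real N..real N} x * u x)"
        using u by (simp add: loc_integrable_def)
    qed (auto simp: w_def indicator_def)
    have eq: "(\<integral>\<^sup>+x. ennreal (w x) * indicator {a<..} x \<partial>lborel)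
        = (\<integral>\<^sup>+x. ennreal (- w x) * indicator {a<..} x \<partial>lborel)" (is "?P = ?M")
      and fin: "(\<integral>\<^sup>+x. ennreal (w x) * indicator {a<..} x \<partial>lborel) < \<infinity>" for a
    proof -
      let ?w = "\<lambda>x. indicator {a<..} x * w x"
      \<comment> \<open>The cutoff turns the half-line into a bounded interval, to which the
        interval statement applies; for a \<ge> N it is empty.\<close>
      have "?w x = indicator {max a (- real N)<..<real N} x * u x" for x
        by (auto simp: w_def indicator_def)
      then have "(LINT x|lborel. ?w x) = 0"
        using interval_integral_eq_0_of_test_integrals[OF assms] by simp
      then have *: "enn2real (\<integral>\<^sup>+x. ennreal (?w x) \<partial>lborel) = enn2real (\<integral>\<^sup>+x. ennreal (- ?w x) \<partial>lborel)"
        using real_lebesgue_integral_def[OF int[of "{a<..}"]] by simp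
      have P: "?P = (\<integral>\<^sup>+x. ennreal (?w x) \<partial>lborel)" "?M = (\<integral>\<^sup>+x. ennreal (- ?w x) \<partial>lborel)"
        by (auto intro!: nn_integral_cong simp: indicator_def)
      have ne: "(\<integral>\<^sup>+x. ennreal (?w x) \<partial>lborel) \<noteq> top" "(\<integral>\<^sup>+x. ennreal (- ?w x) \<partial>lborel) \<noteq> top"
        using int[of "{a<..}"] by (simp_all add: real_integrable_def)
      have inj: "A = B" if "enn2real A = enn2real B" "A \<noteq> top" "B \<noteq> top" for A B
        using that by (metis ennreal_enn2real_if)
      show "?P = ?M"
        unfolding P by (rule inj[OF * ne])
      show "?P < \<infinity>"
        using ne(1) unfolding P by (simp only: top.not_eq_extremum infinity_ennreal_def)
    qed
    have "density lborel (\<lambda>x. ennreal (w x)) = density lborel (\<lambda>x. ennreal (- w x))"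
      by (rule measure_eqI_lessThan) (simp_all add: emeasure_density eq fin[unfolded eq infinity_ennreal_def])
    moreover have "(\<integral>\<^sup>+x. ennreal (w x) \<partial>lborel) \<noteq> \<infinity>"
      using int[of UNIV] by (simp add: real_integrable_def)
    ultimately have "AE x in lborel. ennreal (w x) = ennreal (- w x)"
      using finite_density_unique[of "\<lambda>x. ennreal (w x)" lborel "\<lambda>x. ennreal (- w x)"] by simp
    then show ?thesis
    proof eventually_elim
      case (elim x)
      \<comment> \<open>\<open>ennreal\<close> sends negative numbers to 0, so the equation says
        that the positive and negative parts of w x coincide; one of them is always 0.\<close>
      then have "w x = 0"
        by (cases "w x" "0::real" rule: linorder_cases) (auto simp: ennreal_neg ennreal_eq_0_iff)
      then show ?case by (auto simp: w_def)
    qed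
  qed
  then have "AE x in lborel. \<forall>N. x \<in> {- real N<..<real N} \<longrightarrow> u x = 0"
    by (subst AE_all_countable) blast
  then show ?thesis
  proof eventually_elim
    case (elim x)
    obtain N where "\<bar>x\<bar> < real N"
      using reals_Archimedean2 by blast
    then have "x \<in> {- real N<..<real N}"
      by auto
    with elim show ?case by blast
  qed
qed

lemma integral_by_parts_vanishes_off:
  assumes "\<And>x. (\<phi> has_real_derivative \<phi>' x) (at x)" "continuous_on UNIV \<phi>'"
    and "\<And>x. (F has_real_derivative F' x) (at x)" "continuous_on UNIV F'"
    and \<phi>: "vanishes_off R \<phi>" "vanishes_off R \<phi>'"
  shows "(LINT x|lborel. \<phi>' x * F x) = - (LINT x|lborel. \<phi> x * F' x)"
proof -
  have c: "continuous_on UNIV \<phi>" "continuous_on UNIV F"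
    using assms(1,3) by (meson DERIV_continuous_on has_field_derivative_at_within)+
  \<comment> \<open>S > R kills the boundary terms, and S > 0 keeps the interval nondegenerate when
    R is negative.\<close>
  define S where "S = max 1 (R + 1)"
  have S: "0 < S" "R < S" by (auto simp: S_def)
  have int: "integrable lborel (\<lambda>x. \<phi>' x * F x)" "integrable lborel (\<lambda>x. \<phi> x * F' x)"
    using assms c by (auto intro: integrable_vanishes_off_mult loc_integrable_continuous)
  have "(LINT x|lborel. (\<phi>' x * F x + \<phi> x * F' x) * indicator {- S..S} x)
      = \<phi> S * F S - \<phi> (- S) * F (- S)"
  proof (rule integral_FTC_Icc_real)
    show "((\<lambda>x. \<phi> x * F x) has_real_derivative \<phi>' x * F x + \<phi> x * F' x) (at x)" for x
      by (auto intro!: derivative_eq_intros assms(1,3))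
    have "continuous_on UNIV (\<lambda>x. \<phi>' x * F x + \<phi> x * F' x)"
      by (intro continuous_intros assms c)
    then show "isCont (\<lambda>x. \<phi>' x * F x + \<phi> x * F' x) x" for x
      by (simp add: continuous_on_eq_continuous_at)
  qed (use S in auto)
  also have "\<dots> = 0"
    using \<phi> S by (simp add: vanishes_off_def)
  also have "(\<lambda>x. (\<phi>' x * F x + \<phi> x * F' x) * indicator {- S..S} x) = (\<lambda>x. \<phi>' x * F x + \<phi> x * F' x)"
  proof
    fix x
    show "(\<phi>' x * F x + \<phi> x * F' x) * indicator {- S..S} x = \<phi>' x * F x + \<phi> x * F' x"
      using \<phi> S by (cases "R < \<bar>x\<bar>") (auto simp: vanishes_off_def indicator_def)
  qed
  finally show ?thesis
    using int by simp
qed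

section \<open>Truncated and fractional operators\<close>

lemma integrable_product_lborel:
  fixes p q :: "real \<Rightarrow> real"
  assumes p: "integrable lborel p" and q: "integrable lborel q"
  shows "integrable (lborel \<Otimes>\<^sub>M lborel) (\<lambda>(x, y). p x * q y)"
proof (rule lborel_pair.Fubini_integrable)
  have [measurable]: "p \<in> borel_measurable borel" "q \<in> borel_measurable borel"
    using p q by (auto dest: borel_measurable_integrable)
  show "(\<lambda>(x, y). p x * q y) \<in> borel_measurable (lborel \<Otimes>\<^sub>M lborel)"
    by measurable
qed (use p q in \<open>auto simp: abs_mult\<close>)

definition truncated_kernel :: "real \<Rightarrow> real \<Rightarrow> real \<Rightarrow> real" where
  "truncated_kernel \<alpha> \<epsilon> z = indicator {z. \<epsilon> < \<bar>z\<bar>} z * stable_kernel \<alpha> z"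

definition truncated_op :: "real \<Rightarrow> real \<Rightarrow> (real \<Rightarrow> real) \<Rightarrow> real \<Rightarrow> real" where
  "truncated_op \<alpha> \<epsilon> u x = (LINT z|lborel. truncated_kernel \<alpha> \<epsilon> z * (u (x + z) - u x))"

text \<open>The natural class for operators with this kernel: outside a neighbourhood of a bounded
  set of base points, the kernel is comparable to the weight used here.\<close>

definition tail_integrable :: "real \<Rightarrow> (real \<Rightarrow> real) \<Rightarrow> bool" where
  "tail_integrable \<alpha> u \<longleftrightarrow> u \<in> borel_measurable borel \<and>
     integrable lborel (\<lambda>y. (1 + \<bar>y\<bar>) powr (- 1 - \<alpha>) * u y)"

definition second_difference :: "(real \<Rightarrow> real) \<Rightarrow> real \<Rightarrow> real \<Rightarrow> real" where
  "second_difference \<phi> x z = \<phi> (x + z) + \<phi> (x - z) - 2 * \<phi> x"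

text \<open>On test functions this is the fractional Laplacian, -(-\<Delta>)^(\<alpha>/2). The
  second difference makes the integral converge absolutely at the origin, without principal value or
  compensator.\<close>

definition fractional_op :: "real \<Rightarrow> (real \<Rightarrow> real) \<Rightarrow> real \<Rightarrow> real" where
  "fractional_op \<alpha> \<phi> x = 1 / 2 * (LINT z|lborel. stable_kernel \<alpha> z * second_difference \<phi> x z)"

lemma truncated_kernel_measurable [measurable]: "truncated_kernel \<alpha> \<epsilon> \<in> borel_measurable borel"
  unfolding truncated_kernel_def by measurable

lemma truncated_kernel_minus [simp]: "truncated_kernel \<alpha> \<epsilon> (- z) = truncated_kernel \<alpha> \<epsilon> z"
  by (simp add: truncated_kernel_def indicator_def)

lemma truncated_kernel_commute: "truncated_kernel \<alpha> \<epsilon> (x - y) = truncated_kernel \<alpha> \<epsilon> (y - x)"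
  by (metis truncated_kernel_minus minus_diff_eq)

lemma tail_integrable_imp_loc_integrable:
  assumes "tail_integrable \<alpha> u" "0 < \<alpha>"
  shows "loc_integrable u"
  unfolding loc_integrable_def
proof
  fix R
  have [measurable]: "u \<in> borel_measurable borel"
    using assms by (simp add: tail_integrable_def)
  \<comment> \<open>On [-R, R] the weight is at least (1+|R|)^(-1-\<alpha>), and the factor inverts
    this minimum.\<close>
  have "integrable lborel (\<lambda>y. (1 + \<bar>R\<bar>) powr (1 + \<alpha>) * ((1 + \<bar>y\<bar>) powr (- 1 - \<alpha>) * u y))"
    using assms by (intro integrable_mult_right) (simp add: tail_integrable_def)
  then show "integrable lborel (\<lambda>y. indicator {- R..R} y * u y)"
  proof (rule Bochner_Integration.integrable_bound, goal_cases)
    case 2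
    show ?case
    proof (intro AE_I2)
      fix y
      have "1 \<le> (1 + \<bar>R\<bar>) powr (1 + \<alpha>) * (1 + \<bar>y\<bar>) powr (- 1 - \<alpha>)" if "y \<in> {- R..R}"
      proof -
        have "(1 + \<bar>R\<bar>) powr (- 1 - \<alpha>) \<le> (1 + \<bar>y\<bar>) powr (- 1 - \<alpha>)"
          using assms that by (intro powr_mono2') auto
        then have "(1 + \<bar>R\<bar>) powr (1 + \<alpha>) * (1 + \<bar>R\<bar>) powr (- 1 - \<alpha>)
            \<le> (1 + \<bar>R\<bar>) powr (1 + \<alpha>) * (1 + \<bar>y\<bar>) powr (- 1 - \<alpha>)"
          by (intro mult_left_mono) auto
        then show ?thesis
          using abs_ge_zero[of R] by (simp flip: powr_add)
      qed
      then have "y \<in> {- R..R} \<Longrightarrow>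
          1 * \<bar>u y\<bar> \<le> (1 + \<bar>R\<bar>) powr (1 + \<alpha>) * (1 + \<bar>y\<bar>) powr (- 1 - \<alpha>) * \<bar>u y\<bar>"
        by (intro mult_right_mono) auto
      then show "norm (indicator {- R..R} y * u y)
          \<le> norm ((1 + \<bar>R\<bar>) powr (1 + \<alpha>) * ((1 + \<bar>y\<bar>) powr (- 1 - \<alpha>) * u y))"
        by (cases "y \<in> {- R..R}") (simp_all add: abs_mult mult.assoc)
    qed
  qed measurable
qed

context
  fixes \<alpha> :: real
  assumes \<alpha>: "0 < \<alpha>" "\<alpha> < 2"
begin

lemma truncated_kernel_integrable: "0 < \<epsilon> \<Longrightarrow> integrable lborel (truncated_kernel \<alpha> \<epsilon>)"
  using integrable_stable_kernel_tail[OF \<alpha>] by (simp add: truncated_kernel_def[abs_def])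

lemma truncated_kernel_nonneg: "0 \<le> truncated_kernel \<alpha> \<epsilon> z"
  by (simp add: truncated_kernel_def stable_kernel_nonneg \<alpha>)

lemma stable_kernel_decay:
  assumes "0 < \<epsilon>" "0 \<le> R"
  obtains C where "0 \<le> C"
    and "\<And>x y. \<bar>x\<bar> \<le> R \<Longrightarrow> \<epsilon> < \<bar>y - x\<bar> \<Longrightarrow> stable_kernel \<alpha> (y - x) \<le> C * (1 + \<bar>y\<bar>) powr (- 1 - \<alpha>)"
proof -
  \<comment> \<open>Chosen so that 1+|y| \<le> 1+R+|y-x| \<le> c0 |y-x|; the last step uses 1+R
    \<le> ((1+R)/\<epsilon>) |y-x|, valid for jumps longer than \<epsilon>.\<close>
  define c0 where "c0 = 1 + (1 + R) / \<epsilon>"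
  have c0: "0 < c0"
    using assms by (auto simp: c0_def intro: add_pos_nonneg)
  note c = stable_const_pos[OF \<alpha>]
  show ?thesis
  proof (rule that[of "stable_const \<alpha> * c0 powr (1 + \<alpha>)"])
    fix x y assume xy: "\<bar>x\<bar> \<le> R" "\<epsilon> < \<bar>y - x\<bar>"
    have "(1 + R) / \<epsilon> * \<epsilon> \<le> (1 + R) / \<epsilon> * \<bar>y - x\<bar>"
      using assms xy by (intro mult_left_mono) auto
    then have "1 + R \<le> (1 + R) / \<epsilon> * \<bar>y - x\<bar>"
      using assms by simp
    moreover have "c0 * \<bar>y - x\<bar> = \<bar>y - x\<bar> + (1 + R) / \<epsilon> * \<bar>y - x\<bar>"
      by (simp only: c0_def ring_distribs mult_1)
    ultimately have "1 + \<bar>y\<bar> \<le> c0 * \<bar>y - x\<bar>"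
      using xy by linarith
    then have "(c0 * \<bar>y - x\<bar>) powr (- 1 - \<alpha>) \<le> (1 + \<bar>y\<bar>) powr (- 1 - \<alpha>)"
      using \<alpha> by (intro powr_mono2') auto
    then have "c0 powr (1 + \<alpha>) * (c0 * \<bar>y - x\<bar>) powr (- 1 - \<alpha>) \<le> c0 powr (1 + \<alpha>) * (1 + \<bar>y\<bar>) powr (- 1 - \<alpha>)"
      by (intro mult_left_mono) auto
    moreover have "c0 powr (1 + \<alpha>) * (c0 * \<bar>y - x\<bar>) powr (- 1 - \<alpha>) = \<bar>y - x\<bar> powr (- 1 - \<alpha>)"
    proof -
      have "c0 powr (1 + \<alpha>) * c0 powr (- 1 - \<alpha>) = 1"
        using c0 by (simp flip: powr_add)
      then show ?thesis
        using c0 by (simp add: powr_mult flip: mult.assoc)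
    qed
    ultimately show "stable_kernel \<alpha> (y - x) \<le> stable_const \<alpha> * c0 powr (1 + \<alpha>) * (1 + \<bar>y\<bar>) powr (- 1 - \<alpha>)"
      using c unfolding stable_kernel_def by (simp add: mult.assoc)
  qed (use c in simp)
qed

lemma integrable_truncated_kernel_product:
  assumes [measurable]: "\<phi> \<in> borel_measurable borel" and M: "\<And>x. \<bar>\<phi> x\<bar> \<le> M"
    and R: "vanishes_off R \<phi>" "0 \<le> R" and u: "tail_integrable \<alpha> u" and "0 < \<epsilon>"
  shows "integrable (lborel \<Otimes>\<^sub>M lborel) (\<lambda>(x, y). \<phi> x * truncated_kernel \<alpha> \<epsilon> (y - x) * u y)"
proof -
  obtain C where C: "0 \<le> C"
    "\<And>x y. \<bar>x\<bar> \<le> R \<Longrightarrow> \<epsilon> < \<bar>y - x\<bar> \<Longrightarrow> stable_kernel \<alpha> (y - x) \<le> C * (1 + \<bar>y\<bar>) powr (- 1 - \<alpha>)"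
    using stable_kernel_decay[OF \<open>0 < \<epsilon>\<close> \<open>0 \<le> R\<close>] by metis
  have [measurable]: "u \<in> borel_measurable borel"
    using u by (simp add: tail_integrable_def)
  have "0 \<le> M"
    using M[of 0] by simp
  have "integrable (lborel \<Otimes>\<^sub>M lborel)
      (\<lambda>(x, y). (M * C * indicator {- R..R} x) * ((1 + \<bar>y\<bar>) powr (- 1 - \<alpha>) * u y))"
    using u by (intro integrable_product_lborel integrable_mult_right integrable_real_indicator
        emeasure_bounded_finite) (auto simp: tail_integrable_def)
  then show ?thesis
  proof (rule Bochner_Integration.integrable_bound, goal_cases)
    case 2
    have "\<bar>\<phi> x * truncated_kernel \<alpha> \<epsilon> (y - x) * u y\<bar>
        \<le> \<bar>(M * C * indicator {- R..R} x) * ((1 + \<bar>y\<bar>) powr (- 1 - \<alpha>) * u y)\<bar>" for x y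
    proof (cases "\<phi> x = 0")
      case False
      then have x: "\<bar>x\<bar> \<le> R"
        using R by (auto simp: vanishes_off_def not_less)
      then have "truncated_kernel \<alpha> \<epsilon> (y - x) \<le> C * (1 + \<bar>y\<bar>) powr (- 1 - \<alpha>)"
        using C by (auto simp: truncated_kernel_def indicator_def)
      then have "\<bar>\<phi> x\<bar> * truncated_kernel \<alpha> \<epsilon> (y - x) \<le> M * (C * (1 + \<bar>y\<bar>) powr (- 1 - \<alpha>))"
        using M \<open>0 \<le> M\<close> by (intro mult_mono truncated_kernel_nonneg) auto
      then have "\<bar>\<phi> x\<bar> * truncated_kernel \<alpha> \<epsilon> (y - x) * \<bar>u y\<bar>
          \<le> M * (C * (1 + \<bar>y\<bar>) powr (- 1 - \<alpha>)) * \<bar>u y\<bar>"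
        by (intro mult_right_mono) auto
      then show ?thesis
        using x C(1) \<open>0 \<le> M\<close> by (simp add: abs_mult truncated_kernel_nonneg abs_le_iff mult_ac)
    qed simp
    then show ?case
      by (intro AE_I2) (auto simp: split_beta)
  qed measurable
qed

lemma
  assumes \<phi>m [measurable]: "\<phi> \<in> borel_measurable borel" and M: "\<And>x. \<bar>\<phi> x\<bar> \<le> M"
    and R: "vanishes_off R \<phi>" "0 \<le> R" and u: "tail_integrable \<alpha> u" and \<epsilon>: "0 < \<epsilon>"
  shows integrable_mult_truncated_op: "integrable lborel (\<lambda>x. \<phi> x * truncated_op \<alpha> \<epsilon> u x)"
    and truncated_op_symmetric:
      "(LINT x|lborel. \<phi> x * truncated_op \<alpha> \<epsilon> u x) = (LINT x|lborel. u x * truncated_op \<alpha> \<epsilon> \<phi> x)"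
proof -
  let ?k = "truncated_kernel \<alpha> \<epsilon>"
  let ?F = "\<lambda>x y. \<phi> x * ?k (y - x) * u y"
  define m where "m = (LINT z|lborel. ?k z)"
  note k = truncated_kernel_integrable[OF \<epsilon>]
  have um [measurable]: "u \<in> borel_measurable borel"
    using u by (simp add: tail_integrable_def)
  have F: "integrable (lborel \<Otimes>\<^sub>M lborel) (\<lambda>(x, y). ?F x y)"
    by (rule integrable_truncated_kernel_product[OF assms])
  have \<phi>u: "integrable lborel (\<lambda>x. \<phi> x * u x)"
  proof (rule Bochner_Integration.integrable_bound)
    show "integrable lborel (\<lambda>x. M * (indicator {- R..R} x * u x))"
      using tail_integrable_imp_loc_integrable[OF u \<alpha>(1)] by (simp add: loc_integrable_def)
    show "AE x in lborel. norm (\<phi> x * u x) \<le> norm (M * (indicator {- R..R} x * u x))"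
    proof (intro AE_I2)
      fix x
      show "norm (\<phi> x * u x) \<le> norm (M * (indicator {- R..R} x * u x))"
        using M[of x] R(1) by (cases "R < \<bar>x\<bar>")
          (auto simp: vanishes_off_def abs_mult indicator_def intro!: mult_right_mono)
    qed
  qed auto
  have split: "truncated_op \<alpha> \<epsilon> h x = (LINT z|lborel. ?k z * h (x + z)) - m * h x"
    if "integrable lborel (\<lambda>z. ?k z * h (x + z))" for h x
    using that k unfolding truncated_op_def m_def by (simp add: ring_distribs)
  have shift: "(LINT z|lborel. ?k z * h (x + z)) = (LINT y|lborel. ?k (y - x) * h y)"
    "integrable lborel (\<lambda>z. ?k z * h (x + z)) \<longleftrightarrow> integrable lborel (\<lambda>y. ?k (y - x) * h y)" for h x
    using lborel_integral_real_affine[of 1 "\<lambda>y. ?k (y - x) * h y" x]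
      lborel_integrable_real_affine_iff[of 1 "\<lambda>y. ?k (y - x) * h y" x] by simp_all
  \<comment> \<open>Fubini gives convergence of the convolution with u only for almost every x with
    \<phi> x \<noteq> 0; where \<phi> x = 0 both sides vanish. For \<phi>, which is bounded, the
    corresponding split below holds at every point.\<close>
  have *: "AE x in lborel. \<phi> x * truncated_op \<alpha> \<epsilon> u x = (LINT y|lborel. ?F x y) - m * (\<phi> x * u x)"
    using lborel_pair.AE_integrable_fst'[OF F]
  proof eventually_elim
    case (elim x)
    show ?case
    proof (cases "\<phi> x = 0")
      case False
      then have "integrable lborel (\<lambda>y. ?k (y - x) * u y)"
        using elim by (simp add: mult.assoc)
      then show ?thesis
        using split[of u x] shift[where h = u and x = x] by (simp add: mult.assoc ring_distribs)
    qed simp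
  qed
  have int1: "integrable lborel (\<lambda>x. (LINT y|lborel. ?F x y))"
    using lborel_pair.integrable_fst'[OF F] by simp
  have int2: "integrable lborel (\<lambda>y. (LINT x|lborel. ?F x y))"
    using lborel_pair.integrable_snd[of ?F] F by (simp add: case_prod_beta')
  have meas: "(\<lambda>x. \<phi> x * truncated_op \<alpha> \<epsilon> u x) \<in> borel_measurable lborel"
    unfolding truncated_op_def by measurable
  show "integrable lborel (\<lambda>x. \<phi> x * truncated_op \<alpha> \<epsilon> u x)"
    using int1 \<phi>u by (subst integrable_cong_AE[OF meas _ *]) (auto intro: borel_measurable_integrable)
  have "(LINT x|lborel. \<phi> x * truncated_op \<alpha> \<epsilon> u x)
      = (LINT x|lborel. (LINT y|lborel. ?F x y) - m * (\<phi> x * u x))"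
    using int1 \<phi>u by (intro integral_cong_AE[OF meas _ *] borel_measurable_integrable) auto
  also have "\<dots> = (LINT x|lborel. (LINT y|lborel. ?F x y)) - m * (LINT x|lborel. \<phi> x * u x)"
    using int1 \<phi>u by simp
  also have "(LINT x|lborel. (LINT y|lborel. ?F x y)) = (LINT y|lborel. (LINT x|lborel. ?F x y))"
    using lborel_pair.Fubini_integral[of ?F] F by simp
  also have "\<dots> - m * (LINT x|lborel. \<phi> x * u x) = (LINT y|lborel. (LINT x|lborel. ?F x y) - m * (\<phi> y * u y))"
    using int2 \<phi>u by simp
  also have "\<dots> = (LINT y|lborel. u y * truncated_op \<alpha> \<epsilon> \<phi> y)"
  proof (intro Bochner_Integration.integral_cong refl)
    fix y
    have "integrable lborel (\<lambda>z. ?k z * \<phi> (y + z))"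
    proof (rule Bochner_Integration.integrable_bound[OF integrable_mult_right[OF k, of M]])
      show "AE z in lborel. norm (?k z * \<phi> (y + z)) \<le> norm (M * ?k z)"
      proof (intro AE_I2)
        fix z
        have "?k z * \<bar>\<phi> (y + z)\<bar> \<le> ?k z * \<bar>M\<bar>"
          using order_trans[OF M abs_ge_self] by (intro mult_left_mono truncated_kernel_nonneg)
        then show "norm (?k z * \<phi> (y + z)) \<le> norm (M * ?k z)"
          by (simp add: abs_mult truncated_kernel_nonneg mult.commute)
      qed
    qed auto
    then have 1: "truncated_op \<alpha> \<epsilon> \<phi> y = (LINT x|lborel. ?k (x - y) * \<phi> x) - m * \<phi> y"
      using split[of \<phi> y] shift(1)[where h = \<phi> and x = y] by simp
    have "?F x y = ?k (x - y) * \<phi> x * u y" for x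
      by (simp add: truncated_kernel_commute[of \<alpha> \<epsilon> y x] mult_ac)
    then have 2: "(LINT x|lborel. ?F x y) = (LINT x|lborel. ?k (x - y) * \<phi> x) * u y"
      by (simp only: integral_mult_left_zero)
    show "(LINT x|lborel. ?F x y) - m * (\<phi> y * u y) = u y * truncated_op \<alpha> \<epsilon> \<phi> y"
      unfolding 1 2 by (simp add: algebra_simps)
  qed
  finally show "(LINT x|lborel. \<phi> x * truncated_op \<alpha> \<epsilon> u x) = (LINT x|lborel. u x * truncated_op \<alpha> \<epsilon> \<phi> x)" .
qed

end

section \<open>Decay of second differences and removal of the cutoff\<close>

context
  fixes \<alpha> :: real
  assumes \<alpha>: "0 < \<alpha>" "\<alpha> < 2"
begin

text \<open>Far from the support, \<phi> x = 0 and the second difference is nonzero only if x+z or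
  x-z falls into the support. Such z fill a set of bounded measure, and there |z| is comparable to
  |x|, so the kernel has the size of the weight. Near the support the weight is bounded below and
  the quadratic bound at the origin suffices.\<close>

lemma second_difference_kernel_bound:
  assumes \<phi>: "\<phi> \<in> C2c"
  obtains C where "0 \<le> C" "\<And>x. integrable lborel (\<lambda>z. stable_kernel \<alpha> z * second_difference \<phi> x z)"
    and "\<And>x. (LINT z|lborel. \<bar>stable_kernel \<alpha> z * second_difference \<phi> x z\<bar>)
          \<le> C * (1 + \<bar>x\<bar>) powr (- 1 - \<alpha>)"
proof -
  let ?S = "second_difference \<phi>" and ?k = "stable_kernel \<alpha>"
  note k0 = stable_kernel_nonneg[OF \<alpha>]
  have C2: "C2 \<phi>"
    using \<phi> by (simp add: C2c_def)
  note cont = C2_D(3-5)[OF C2]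
  have [measurable]: "\<phi> \<in> borel_measurable borel"
    using cont(1) by (rule borel_measurable_continuous_onI)
  obtain R where R: "1 \<le> R" "vanishes_off R \<phi>" "vanishes_off R (deriv (deriv \<phi>))"
    using C2c_vanishes_off[OF \<phi>] by metis
  obtain M0 where M0: "0 \<le> M0" "\<And>x. \<bar>\<phi> x\<bar> \<le> M0"
    using continuous_vanishes_off_bounded[OF cont(1) R(2)] by metis
  obtain M2 where M2: "0 \<le> M2" "\<And>x. \<bar>deriv (deriv \<phi>) x\<bar> \<le> M2"
    using continuous_vanishes_off_bounded[OF cont(3) R(3)] by metis
  \<comment> \<open>The point bounded by R will be x+z or x-z, and the point y of this estimate will
    be the base point. If the base point exceeds 2R in modulus, the jump is longer than R, so R also
    serves as the cutoff.\<close>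
  obtain C1 where C1: "0 \<le> C1" "\<And>x y. \<bar>x\<bar> \<le> R \<Longrightarrow> R < \<bar>y - x\<bar> \<Longrightarrow> ?k (y - x) \<le> C1 * (1 + \<bar>y\<bar>) powr (- 1 - \<alpha>)"
    using stable_kernel_decay[OF \<alpha>, of R R] R(1) by (metis less_eq_real_def less_le_trans zero_less_one)
  define M where "M = 4 * M0 + 2 * M2"
  have M: "0 \<le> M" "4 * M0 \<le> M" "2 * M2 \<le> M"
    using M0(1) M2(1) by (auto simp: M_def)
  have S_le: "\<bar>?S x z\<bar> \<le> M * min 1 (z\<^sup>2)" for x z
  proof -
    have "\<bar>?S x z\<bar> \<le> 4 * M0"
      using M0(2)[of "x + z"] M0(2)[of "x - z"] M0(2)[of x] by (simp add: second_difference_def)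
    moreover have "\<bar>?S x z\<bar> \<le> 2 * M2 * z\<^sup>2"
      unfolding second_difference_def by (rule second_difference_bound[OF C2 M2(2)])
    moreover have "2 * M2 * z\<^sup>2 \<le> M * z\<^sup>2"
      using M by (intro mult_right_mono) auto
    ultimately show ?thesis
      using M by (auto simp: min_def)
  qed
  define w where "w = (\<lambda>x::real. (1 + \<bar>x\<bar>) powr (- 1 - \<alpha>))"
  \<comment> \<open>The two intervals collect the z with x+z or x-z in [-R, R]. Each has length 2R
    whatever x is, so the integral of G x does not depend on x.\<close>
  define G where "G = (\<lambda>x z. indicator {- R - x..R - x} z + indicator {x - R..x + R} z + min 1 (z\<^sup>2) * ?k z)"
  \<comment> \<open>The first summand serves |x| \<le> 2R, where its product with w x is at least 1;
    the second serves |x| > 2R.\<close>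
  define C where "C = M * ((1 + 2 * R) powr (1 + \<alpha>) + C1)"
  have "0 \<le> C"
    using M C1 by (simp add: C_def)
  have bound: "\<bar>?k z * ?S x z\<bar> \<le> C * w x * G x z" for x z
  proof (cases "\<bar>x\<bar> \<le> 2 * R")
    case True
    have "(1 + 2 * R) powr (- 1 - \<alpha>) \<le> w x"
      unfolding w_def using True \<alpha> by (intro powr_mono2') auto
    then have "(1 + 2 * R) powr (1 + \<alpha>) * (1 + 2 * R) powr (- 1 - \<alpha>) \<le> (1 + 2 * R) powr (1 + \<alpha>) * w x"
      by (intro mult_left_mono) auto
    then have 1: "1 \<le> (1 + 2 * R) powr (1 + \<alpha>) * w x"
      using R(1) by (simp flip: powr_add)
    have "0 \<le> C1 * w x"
      using C1(1) by (simp add: w_def)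
    with 1 have "M * 1 \<le> M * ((1 + 2 * R) powr (1 + \<alpha>) * w x + C1 * w x)"
      using M by (intro mult_left_mono) auto
    then have C: "M \<le> C * w x"
      by (simp add: C_def algebra_simps)
    have "\<bar>?k z * ?S x z\<bar> \<le> ?k z * (M * min 1 (z\<^sup>2))"
      using S_le by (simp add: abs_mult k0 mult_left_mono)
    also have "\<dots> \<le> C * w x * (min 1 (z\<^sup>2) * ?k z)"
      using mult_right_mono[OF C, of "min 1 (z\<^sup>2) * ?k z"] k0[of z] by (simp add: mult_ac)
    also have "\<dots> \<le> C * w x * G x z"
      using \<open>0 \<le> C\<close> by (intro mult_left_mono) (auto simp: G_def w_def)
    finally show ?thesis .
  next
    case False
    then have \<phi>x: "\<phi> x = 0"
      using R(1,2) by (auto simp: vanishes_off_def)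
    show ?thesis
    proof (cases "\<bar>x + z\<bar> \<le> R \<or> \<bar>x - z\<bar> \<le> R")
      case True
      have "?k z \<le> C1 * w x"
        using True
      proof
        assume "\<bar>x + z\<bar> \<le> R"
        then have "?k (x - (x + z)) \<le> C1 * w x"
          unfolding w_def using False by (intro C1(2)) auto
        then show ?thesis by simp
      next
        assume "\<bar>x - z\<bar> \<le> R"
        then have "?k (x - (x - z)) \<le> C1 * w x"
          unfolding w_def using False by (intro C1(2)) auto
        then show ?thesis by simp
      qed
      moreover have "\<bar>?S x z\<bar> \<le> M"
        using S_le[of x z] M(1) mult_left_mono[of "min 1 (z\<^sup>2)" 1 M] by simp
      ultimately have "\<bar>?k z * ?S x z\<bar> \<le> C1 * w x * M"
        by (simp add: abs_mult k0) (meson abs_ge_zero k0 mult_mono order_trans)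
      also have "\<dots> \<le> C * w x * 1"
        using M(1) by (simp add: C_def w_def ring_distribs mult_ac)
      also have "\<dots> \<le> C * w x * G x z"
        using True \<open>0 \<le> C\<close> k0[of z] by (intro mult_left_mono) (auto simp: G_def w_def indicator_def)
      finally show ?thesis .
    next
      case F: False
      then have "?S x z = 0"
        using R(2) \<phi>x by (auto simp: second_difference_def vanishes_off_def)
      then show ?thesis
        using \<open>0 \<le> C\<close> k0[of z] by (simp add: G_def w_def)
    qed
  qed
  have G: "integrable lborel (G x)" for x
    unfolding G_def
    by (intro Bochner_Integration.integrable_add integrable_min_stable_kernel[OF \<alpha>] integrable_real_indicator
        emeasure_bounded_finite) auto
  have "(LINT z|lborel. G x z) = 4 * R + (LINT z|lborel. min 1 (z\<^sup>2) * ?k z)" (is "_ = ?g") for x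
    unfolding G_def
    using R(1) integrable_min_stable_kernel[OF \<alpha>]
    by (subst Bochner_Integration.integral_add) (auto intro!: integrable_real_indicator emeasure_bounded_finite)
  note intG = this
  show thesis
  proof
    show int: "integrable lborel (\<lambda>z. ?k z * ?S x z)" for x
    proof (rule Bochner_Integration.integrable_bound[OF integrable_mult_right[OF G, of "C * w x" x]])
      show "AE z in lborel. norm (?k z * ?S x z) \<le> norm (C * w x * G x z)"
        using bound[of _ x] by (intro AE_I2) (smt (verit) real_norm_def)
    qed (simp add: second_difference_def)
    show "(LINT z|lborel. \<bar>?k z * ?S x z\<bar>) \<le> C * ?g * (1 + \<bar>x\<bar>) powr (- 1 - \<alpha>)" for x
    proof -
      have "(LINT z|lborel. \<bar>?k z * ?S x z\<bar>) \<le> (LINT z|lborel. C * w x * G x z)"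
        using int bound by (intro integral_mono integrable_abs integrable_mult_right G) auto
      then show ?thesis
        by (simp add: intG w_def mult_ac)
    qed
    have "0 \<le> (LINT z|lborel. min 1 (z\<^sup>2) * ?k z)"
      using k0 by (intro integral_nonneg_AE) auto
    then show "0 \<le> C * ?g"
      using \<open>0 \<le> C\<close> R(1) by (intro mult_nonneg_nonneg) auto
  qed
qed

text \<open>The cutoff region is symmetric, so evenness of the kernel replaces first differences by
  second ones, in which form \<epsilon> can tend to 0.\<close>

lemma truncated_op_eq_second_difference:
  assumes "\<phi> \<in> C2c" "0 < \<epsilon>"
  shows "truncated_op \<alpha> \<epsilon> \<phi> x = 1 / 2 *
    (LINT z|lborel. indicator {z. \<epsilon> < \<bar>z\<bar>} z * (stable_kernel \<alpha> z * second_difference \<phi> x z))"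
proof -
  have cont: "continuous_on UNIV \<phi>"
    using assms by (auto simp: C2c_def intro: C2_D)
  then have [measurable]: "\<phi> \<in> borel_measurable borel"
    by (rule borel_measurable_continuous_onI)
  obtain R where "vanishes_off R \<phi>"
    using C2c_vanishes_off[OF assms(1)] by metis
  then obtain M where M: "0 \<le> M" "\<And>x. \<bar>\<phi> x\<bar> \<le> M"
    using continuous_vanishes_off_bounded[OF cont] by metis
  let ?H = "\<lambda>z. indicator {z. \<epsilon> < \<bar>z\<bar>} z * (\<phi> (x + z) - \<phi> x)"
  have "integrable lborel (\<lambda>z. stable_kernel \<alpha> z * ?H z)"
  proof (rule Bochner_Integration.integrable_bound[OF integrable_mult_right[OF
          truncated_kernel_integrable[OF \<alpha> assms(2)], of "2 * M"]])
    show "AE z in lborel. norm (stable_kernel \<alpha> z * ?H z) \<le> norm (2 * M * truncated_kernel \<alpha> \<epsilon> z)"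
    proof (intro AE_I2)
      fix z
      have "\<bar>\<phi> (x + z) - \<phi> x\<bar> \<le> 2 * M"
        using M(2)[of "x + z"] M(2)[of x] by linarith
      then have "truncated_kernel \<alpha> \<epsilon> z * \<bar>\<phi> (x + z) - \<phi> x\<bar> \<le> truncated_kernel \<alpha> \<epsilon> z * (2 * M)"
        by (intro mult_left_mono truncated_kernel_nonneg[OF \<alpha>])
      then have "norm (truncated_kernel \<alpha> \<epsilon> z * (\<phi> (x + z) - \<phi> x)) \<le> norm (2 * M * truncated_kernel \<alpha> \<epsilon> z)"
        using M(1) by (simp add: abs_mult truncated_kernel_nonneg[OF \<alpha>] mult_ac)
      then show "norm (stable_kernel \<alpha> z * ?H z) \<le> norm (2 * M * truncated_kernel \<alpha> \<epsilon> z)"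
        by (simp add: truncated_kernel_def mult_ac)
    qed
  qed measurable
  from stable_kernel_symmetrize(2)[OF this]
  show ?thesis
    by (simp add: truncated_op_def truncated_kernel_def second_difference_def algebra_simps
        indicator_def cong: if_cong)
qed

lemma
  assumes \<phi>: "\<phi> \<in> C2c" and u: "tail_integrable \<alpha> u"
  shows integrable_mult_fractional_op: "integrable lborel (\<lambda>x. u x * fractional_op \<alpha> \<phi> x)"
    and tendsto_integral_truncated_op:
      "((\<lambda>\<epsilon>. LINT x|lborel. u x * truncated_op \<alpha> \<epsilon> \<phi> x) \<longlongrightarrow> (LINT x|lborel. u x * fractional_op \<alpha> \<phi> x)) (at_right 0)"
proof -
  let ?S = "\<lambda>x z. stable_kernel \<alpha> z * second_difference \<phi> x z"
  let ?w = "\<lambda>x::real. (1 + \<bar>x\<bar>) powr (- 1 - \<alpha>)"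
  have [measurable]: "u \<in> borel_measurable borel"
    using u by (simp add: tail_integrable_def)
  have "continuous_on UNIV \<phi>"
    using assms by (auto simp: C2c_def intro: C2_D)
  then have [measurable]: "\<phi> \<in> borel_measurable borel"
    by (rule borel_measurable_continuous_onI)
  have Sm [measurable]: "case_prod (second_difference \<phi>) \<in> borel_measurable (borel \<Otimes>\<^sub>M borel)"
    unfolding second_difference_def by measurable
  obtain C where C: "0 \<le> C" "\<And>x. integrable lborel (?S x)"
    "\<And>x. (LINT z|lborel. \<bar>?S x z\<bar>) \<le> C * ?w x"
    using second_difference_kernel_bound[OF \<phi>] by metis
  have dom: "integrable lborel (\<lambda>x. C * \<bar>?w x * u x\<bar>)"
    using u by (intro integrable_mult_right integrable_abs) (simp add: tail_integrable_def)
  \<comment> \<open>The multiplier h is 1 for the fractional operator and the indicator of {|z| >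
    \<epsilon>} for its truncations, so all of them share one majorant.\<close>
  have le: "\<bar>u x * (1 / 2 * (LINT z|lborel. h z * ?S x z))\<bar> \<le> C * \<bar>?w x * u x\<bar>"
    if [measurable]: "h \<in> borel_measurable borel" and h: "\<And>z. \<bar>h z\<bar> \<le> 1" for x h
  proof -
    have hS: "\<bar>h z * ?S x z\<bar> \<le> \<bar>?S x z\<bar>" for z
      using h[of z] by (simp add: abs_mult mult_left_le_one_le)
    have int: "integrable lborel (\<lambda>z. h z * ?S x z)"
      by (rule Bochner_Integration.integrable_bound[OF C(2)[of x]]) (use hS in auto)
    have "\<bar>LINT z|lborel. h z * ?S x z\<bar> \<le> (LINT z|lborel. \<bar>h z * ?S x z\<bar>)"
      using integral_norm_bound[of lborel "\<lambda>z. h z * ?S x z"] by simp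
    also have "\<dots> \<le> (LINT z|lborel. \<bar>?S x z\<bar>)"
      using int C(2) hS by (intro integral_mono integrable_abs) auto
    also have "\<dots> \<le> C * ?w x"
      by (rule C(3))
    finally have "\<bar>u x\<bar> * (1 / 2 * \<bar>LINT z|lborel. h z * ?S x z\<bar>) \<le> \<bar>u x\<bar> * (C * ?w x)"
      by (intro mult_left_mono) auto
    then show ?thesis
      by (simp add: abs_mult mult_ac)
  qed
  have meas: "(\<lambda>x. LINT z|lborel. h z * ?S x z) \<in> borel_measurable borel"
    if [measurable]: "h \<in> borel_measurable borel" for h
    by measurable
  show "integrable lborel (\<lambda>x. u x * fractional_op \<alpha> \<phi> x)"
  proof (rule Bochner_Integration.integrable_bound[OF dom])
    show "(\<lambda>x. u x * fractional_op \<alpha> \<phi> x) \<in> borel_measurable lborel"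
      unfolding fractional_op_def using meas[of "\<lambda>_. 1"] by simp
    show "AE x in lborel. norm (u x * fractional_op \<alpha> \<phi> x) \<le> norm (C * \<bar>?w x * u x\<bar>)"
      using le[of "\<lambda>_. 1"] C(1) by (simp add: fractional_op_def)
  qed
  show "((\<lambda>\<epsilon>. LINT x|lborel. u x * truncated_op \<alpha> \<epsilon> \<phi> x) \<longlongrightarrow> (LINT x|lborel. u x * fractional_op \<alpha> \<phi> x)) (at_right 0)"
    \<comment> \<open>Dominated convergence is a statement about sequences, so the one-sided limit
      is tested along arbitrary positive null sequences.\<close>
    unfolding tendsto_at_iff_sequentially
  proof (intro allI impI, unfold comp_def)
    fix X :: "nat \<Rightarrow> real"
    assume "\<forall>i. X i \<in> {0<..} - {0}" and X: "X \<longlonglongrightarrow> 0"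
    then have pos: "0 < X i" for i
      by auto
    let ?h = "\<lambda>i. indicator {z. X i < \<bar>z\<bar>} :: real \<Rightarrow> real"
    have T: "truncated_op \<alpha> (X i) \<phi> x = 1 / 2 * (LINT z|lborel. ?h i z * ?S x z)" for i x
      by (rule truncated_op_eq_second_difference[OF \<phi> pos])
    show "(\<lambda>i. LINT x|lborel. u x * truncated_op \<alpha> (X i) \<phi> x) \<longlonglongrightarrow> (LINT x|lborel. u x * fractional_op \<alpha> \<phi> x)"
      unfolding T fractional_op_def
    proof (rule integral_dominated_convergence[OF _ _ dom])
      show "(\<lambda>x. u x * (1 / 2 * (LINT z|lborel. ?S x z))) \<in> borel_measurable lborel"
        using meas[of "\<lambda>_. 1"] by simp
      show "(\<lambda>x. u x * (1 / 2 * (LINT z|lborel. ?h i z * ?S x z))) \<in> borel_measurable lborel" for i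
        using meas[of "?h i"] by simp
      show "AE x in lborel. norm (u x * (1 / 2 * (LINT z|lborel. ?h i z * ?S x z))) \<le> C * \<bar>?w x * u x\<bar>" for i
        using le[of "?h i"] by (simp add: indicator_def)
      show "AE x in lborel. (\<lambda>i. u x * (1 / 2 * (LINT z|lborel. ?h i z * ?S x z)))
          \<longlonglongrightarrow> u x * (1 / 2 * (LINT z|lborel. ?S x z))"
      proof (intro AE_I2 tendsto_mult tendsto_const)
        fix x
        show "(\<lambda>i. LINT z|lborel. ?h i z * ?S x z) \<longlonglongrightarrow> (LINT z|lborel. ?S x z)"
        proof (rule integral_dominated_convergence[where w = "\<lambda>z. \<bar>?S x z\<bar>"])
          show "AE z in lborel. (\<lambda>i. ?h i z * ?S x z) \<longlonglongrightarrow> ?S x z"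
          proof (intro AE_I2)
            fix z
            show "(\<lambda>i. ?h i z * ?S x z) \<longlonglongrightarrow> ?S x z"
            \<comment> \<open>At the origin the indicator stays 0 for every cutoff, but the kernel
              is 0 there by \<open>0 powr a = 0\<close>.\<close>
            proof (cases "z = 0")
              case False
              then have "\<forall>\<^sub>F i in sequentially. X i < \<bar>z\<bar>"
                using X by (intro order_tendstoD) auto
              then have "\<forall>\<^sub>F i in sequentially. ?h i z * ?S x z = ?S x z"
                by eventually_elim simp
              then show ?thesis
                by (rule tendsto_eventually)
            qed (simp add: stable_kernel_def)
          qed
          show "integrable lborel (\<lambda>z. \<bar>?S x z\<bar>)"
            by (intro integrable_abs C(2))
        qed (auto simp: indicator_def)
      qed
    qed
  qed
qed

end

section \<open>The adjoint of the generator\<close>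

lemma abs_le_sqrt_mult:
  fixes a d \<gamma> :: real
  assumes "a\<^sup>2 \<le> \<gamma> * d\<^sup>2" "0 \<le> \<gamma>"
  shows "\<bar>a\<bar> \<le> sqrt \<gamma> * \<bar>d\<bar>"
proof -
  have "sqrt (a\<^sup>2) \<le> sqrt (\<gamma> * d\<^sup>2)"
    using assms(1) by (rule real_sqrt_le_mono)
  then show ?thesis
    by (simp add: real_sqrt_mult)
qed

text \<open>For index 1 the kernel is a multiple of 1/z^2, so its tail is already known to be
  integrable.\<close>

lemma integrable_inverse_square_tail: "integrable lborel (\<lambda>y::real. 1 / (1 + \<bar>y\<bar>)\<^sup>2)"
proof (rule Bochner_Integration.integrable_bound)
  have "integrable lborel (\<lambda>z. 1 / stable_const 1 * (indicator {z. 1 < \<bar>z\<bar>} z * stable_kernel 1 z))"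
    by (intro integrable_mult_right integrable_stable_kernel_tail) auto
  then show "integrable lborel (\<lambda>z. indicator {-1..1::real} z
      + 1 / stable_const 1 * (indicator {z. 1 < \<bar>z\<bar>} z * stable_kernel 1 z))"
    by (intro Bochner_Integration.integrable_add integrable_real_indicator emeasure_bounded_finite) auto
  show "AE z in lborel. norm (1 / (1 + \<bar>z\<bar>)\<^sup>2) \<le> norm (indicator {-1..1::real} z
      + 1 / stable_const 1 * (indicator {z. 1 < \<bar>z\<bar>} z * stable_kernel 1 z))"
  proof (intro AE_I2)
    fix z :: real
    have c: "0 < stable_const 1"
      by (rule stable_const_pos) auto
    show "norm (1 / (1 + \<bar>z\<bar>)\<^sup>2) \<le> norm (indicator {-1..1::real} z
      + 1 / stable_const 1 * (indicator {z. 1 < \<bar>z\<bar>} z * stable_kernel 1 z))"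
    proof (cases "\<bar>z\<bar> \<le> 1")
      case True
      have "1 \<le> (1 + \<bar>z\<bar>)\<^sup>2"
        by (rule one_le_power) simp
      then have "1 / (1 + \<bar>z\<bar>)\<^sup>2 \<le> 1"
        by (simp add: divide_le_eq_1)
      moreover have "z \<in> {-1..1}" "\<not> 1 < \<bar>z\<bar>"
        using True by auto
      ultimately show ?thesis
        by simp
    next
      case False
      then have "stable_kernel 1 z = stable_const 1 * (1 / \<bar>z\<bar>\<^sup>2)"
        by (simp add: stable_kernel_def powr_minus_divide powr_numeral)
      moreover have "1 / (1 + \<bar>z\<bar>)\<^sup>2 \<le> 1 / \<bar>z\<bar>\<^sup>2"
        using False by (intro divide_left_mono power_mono zero_less_power mult_pos_pos) auto
      ultimately show ?thesis
        using c False by (simp add: indicator_def)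
    qed
  qed
qed auto

lemma L2_imp_borel: "L2 v \<Longrightarrow> v \<in> borel_measurable borel"
  by (simp add: L2_def)

lemma C2c_D:
  assumes "\<phi> \<in> C2c"
  shows "C2 \<phi>" "continuous_on UNIV \<phi>" "\<phi> \<in> borel_measurable borel"
    and "loc_integrable u \<Longrightarrow> integrable lborel (\<lambda>x. \<phi> x * u x)"
proof -
  show "C2 \<phi>" using assms by (simp add: C2c_def)
  then show c: "continuous_on UNIV \<phi>" by (rule C2_D)
  then show "\<phi> \<in> borel_measurable borel" by (rule borel_measurable_continuous_onI)
  show "integrable lborel (\<lambda>x. \<phi> x * u x)" if "loc_integrable u"
    using C2c_vanishes_off[OF assms] integrable_vanishes_off_mult[OF c _ that] by metis
qed

lemma AE_eq_of_test_integrals: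
  assumes "u \<in> borel_measurable borel" "v \<in> borel_measurable borel"
    and "loc_integrable u" "loc_integrable v"
    and "\<And>\<phi>. \<phi> \<in> C2c \<Longrightarrow> (LINT x|lborel. \<phi> x * u x) = (LINT x|lborel. \<phi> x * v x)"
  shows "AE x in lborel. u x = v x"
proof -
  have "AE x in lborel. u x - v x = 0"
    using assms
    by (intro AE_eq_0_of_test_integrals loc_integrable_diff borel_measurable_diff)
       (auto simp: right_diff_distrib C2c_D(4))
  then show ?thesis by simp
qed

section \<open>Weak Fokker-Planck formula and the adjoint on test functions\<close>

context
  fixes \<alpha> :: real and f g \<sigma> :: "real \<Rightarrow> real"
  assumes \<alpha>: "0 < \<alpha>" "\<alpha> < 2"
    and H1: "\<exists>\<gamma>>0. \<forall>x1 x2.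
        \<bar>f x1 - f x2\<bar>\<^sup>2 + \<bar>g x1 - g x2\<bar>\<^sup>2
        + (LINT y:{y. \<bar>y\<bar> < 1}|stable_nu \<alpha>. \<bar>\<sigma> x1 * y - \<sigma> x2 * y\<bar>\<^sup>2)
        \<le> \<gamma> * \<bar>x1 - x2\<bar>\<^sup>2"
    and \<sigma>: "\<And>x. \<sigma> x \<noteq> 0"
    and dom: "generator_domain \<alpha> f g \<sigma> C2c"
begin

abbreviation (input) weighted :: "(real \<Rightarrow> real) \<Rightarrow> real \<Rightarrow> real" where
  "weighted v \<equiv> \<lambda>x. \<bar>\<sigma> x\<bar> powr \<alpha> * v x"

text \<open>The jump size y factors out of the integral in \<open>H1\<close>, leaving a sum of three
  nonnegative terms, each of which is bounded by the right-hand side alone.\<close>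

lemma coefficients_Lipschitz:
  obtains L where "0 \<le> L" "L-lipschitz_on UNIV f" "L-lipschitz_on UNIV g" "L-lipschitz_on UNIV \<sigma>"
proof -
  obtain \<gamma> where \<gamma>: "0 < \<gamma>" and le: "\<And>x1 x2. \<bar>f x1 - f x2\<bar>\<^sup>2 + \<bar>g x1 - g x2\<bar>\<^sup>2
        + (LINT y:{y. \<bar>y\<bar> < 1}|stable_nu \<alpha>. \<bar>\<sigma> x1 * y - \<sigma> x2 * y\<bar>\<^sup>2)
        \<le> \<gamma> * \<bar>x1 - x2\<bar>\<^sup>2"
    using H1 by blast
  define I where "I = (LINT y:{y. \<bar>y\<bar> < 1}|stable_nu \<alpha>. y\<^sup>2)"
  have I: "0 < I"
    unfolding I_def by (rule stable_nu_second_moment_pos[OF \<alpha>])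
  have "(LINT y:{y. \<bar>y\<bar> < 1}|stable_nu \<alpha>. \<bar>\<sigma> x1 * y - \<sigma> x2 * y\<bar>\<^sup>2) = (\<sigma> x1 - \<sigma> x2)\<^sup>2 * I" for x1 x2
    unfolding I_def by (simp add: power_mult_distrib flip: left_diff_distrib)
  with le have le: "(f x1 - f x2)\<^sup>2 + (g x1 - g x2)\<^sup>2 + (\<sigma> x1 - \<sigma> x2)\<^sup>2 * I \<le> \<gamma> * (x1 - x2)\<^sup>2" for x1 x2
    by simp
  have nonneg: "0 \<le> (\<sigma> x1 - \<sigma> x2)\<^sup>2 * I" for x1 x2
    using I by simp
  have fg: "(f x1 - f x2)\<^sup>2 \<le> \<gamma> * (x1 - x2)\<^sup>2" "(g x1 - g x2)\<^sup>2 \<le> \<gamma> * (x1 - x2)\<^sup>2"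
    and s: "(\<sigma> x1 - \<sigma> x2)\<^sup>2 * I \<le> \<gamma> * (x1 - x2)\<^sup>2" for x1 x2
    using le[of x1 x2] nonneg[of x1 x2] zero_le_power2[of "f x1 - f x2"] zero_le_power2[of "g x1 - g x2"]
    by linarith+
  have s: "(\<sigma> x1 - \<sigma> x2)\<^sup>2 \<le> \<gamma> / I * (x1 - x2)\<^sup>2" for x1 x2
    using s[of x1 x2] I by (simp add: pos_le_divide_eq)
  define L where "L = sqrt \<gamma> + sqrt (\<gamma> / I)"
  have L: "0 \<le> L" "sqrt \<gamma> \<le> L" "sqrt (\<gamma> / I) \<le> L"
    using \<gamma> I by (auto simp: L_def)
  have lip: "L-lipschitz_on UNIV h"
    if "\<And>x1 x2. (h x1 - h x2)\<^sup>2 \<le> \<delta> * (x1 - x2)\<^sup>2" "0 \<le> \<delta>" "sqrt \<delta> \<le> L" for h :: "real \<Rightarrow> real" and \<delta>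
  proof (rule lipschitz_onI)
    show "dist (h x) (h y) \<le> L * dist x y" for x y
      using abs_le_sqrt_mult[OF that(1,2), of x y] mult_right_mono[OF that(3), of "\<bar>x - y\<bar>"]
      by (simp add: dist_real_def)
  qed (rule L)
  show thesis
    by (rule that[OF L(1) lip[OF fg(1)] lip[OF fg(2)] lip[OF s]]) (use \<gamma> I L in auto)
qed

lemma coefficients_continuous:
  "continuous_on UNIV f" "continuous_on UNIV g" "continuous_on UNIV \<sigma>"
  using coefficients_Lipschitz lipschitz_on_continuous_on by metis+

lemma weight_growth:
  obtains C where "0 \<le> C" "\<And>x. \<bar>\<sigma> x\<bar> powr \<alpha> \<le> C * (1 + \<bar>x\<bar>) powr \<alpha>"
proof -
  obtain L where L: "0 \<le> L" "L-lipschitz_on UNIV \<sigma>"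
    using coefficients_Lipschitz by metis
  \<comment> \<open>This makes |\<sigma> 0| + L |x| \<le> c (1+|x|).\<close>
  define c where "c = \<bar>\<sigma> 0\<bar> + L"
  have "\<bar>\<sigma> x\<bar> powr \<alpha> \<le> c powr \<alpha> * (1 + \<bar>x\<bar>) powr \<alpha>" for x
  proof -
    have "\<bar>\<sigma> x - \<sigma> 0\<bar> \<le> L * \<bar>x\<bar>"
      using lipschitz_onD[OF L(2), of x 0] by (simp add: dist_real_def)
    then have "\<bar>\<sigma> x\<bar> \<le> \<bar>\<sigma> 0\<bar> + L * \<bar>x\<bar>"
      by linarith
    also have "\<dots> \<le> c * (1 + \<bar>x\<bar>)"
      using L(1) by (simp add: c_def algebra_simps)
    finally have "\<bar>\<sigma> x\<bar> powr \<alpha> \<le> (c * (1 + \<bar>x\<bar>)) powr \<alpha>"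
      using \<alpha> by (intro powr_mono2) auto
    then show ?thesis
      using L(1) by (simp add: powr_mult c_def)
  qed
  then show thesis
    by (intro that[of "c powr \<alpha>"]) auto
qed

text \<open>The weight grows like \<open>\<bar>x\<bar> powr \<alpha>\<close>, so the decay of the kernel leaves a factor
  \<open>1 / (1 + \<bar>x\<bar>)\<close>, which is square integrable on the line.\<close>

lemma tail_integrable_weighted:
  assumes v: "L2 v"
  shows "tail_integrable \<alpha> (weighted v)"
proof -
  have [measurable]: "v \<in> borel_measurable borel"
    using v by (rule L2_imp_borel)
  have [measurable]: "\<sigma> \<in> borel_measurable borel"
    using coefficients_continuous(3) by (rule borel_measurable_continuous_onI)
  obtain C where C: "0 \<le> C" "\<And>x. \<bar>\<sigma> x\<bar> powr \<alpha> \<le> C * (1 + \<bar>x\<bar>) powr \<alpha>"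
    using weight_growth by metis
  have "integrable lborel (\<lambda>y. (1 + \<bar>y\<bar>) powr (- 1 - \<alpha>) * weighted v y)"
  proof (rule Bochner_Integration.integrable_bound)
    show "integrable lborel (\<lambda>y. C * (1 / (1 + \<bar>y\<bar>)\<^sup>2 + (v y)\<^sup>2))"
      using v integrable_inverse_square_tail by (simp add: L2_def)
    show "AE y in lborel. norm ((1 + \<bar>y\<bar>) powr (- 1 - \<alpha>) * weighted v y)
        \<le> norm (C * (1 / (1 + \<bar>y\<bar>)\<^sup>2 + (v y)\<^sup>2))"
    proof (intro AE_I2)
      fix y
      have "(1 + \<bar>y\<bar>) powr (- 1 - \<alpha>) * (1 + \<bar>y\<bar>) powr \<alpha> = (1 + \<bar>y\<bar>) powr (- 1)"
        by (subst powr_add[symmetric]) simp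
      also have "\<dots> = 1 / (1 + \<bar>y\<bar>)"
        by (simp add: powr_minus_divide)
      finally have *: "(1 + \<bar>y\<bar>) powr (- 1 - \<alpha>) * (1 + \<bar>y\<bar>) powr \<alpha> = 1 / (1 + \<bar>y\<bar>)" .
      have "(1 + \<bar>y\<bar>) powr (- 1 - \<alpha>) * (\<bar>\<sigma> y\<bar> powr \<alpha> * \<bar>v y\<bar>)
          \<le> (1 + \<bar>y\<bar>) powr (- 1 - \<alpha>) * (C * (1 + \<bar>y\<bar>) powr \<alpha> * \<bar>v y\<bar>)"
        using C by (intro mult_left_mono mult_right_mono) auto
      also have "\<dots> = C * ((1 + \<bar>y\<bar>) powr (- 1 - \<alpha>) * (1 + \<bar>y\<bar>) powr \<alpha>) * \<bar>v y\<bar>"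
        by (simp only: mult_ac)
      also have "\<dots> = C * (1 / (1 + \<bar>y\<bar>) * \<bar>v y\<bar>)"
        by (simp only: * mult.assoc)
      also have "1 / (1 + \<bar>y\<bar>) * \<bar>v y\<bar> \<le> (1 / (1 + \<bar>y\<bar>))\<^sup>2 + \<bar>v y\<bar>\<^sup>2"
      proof -
        have "a * b \<le> a\<^sup>2 + b\<^sup>2" for a b :: real
          using zero_le_power2[of "a - b"] zero_le_power2[of "a + b"]
          by (simp add: power2_eq_square algebra_simps)
        then show ?thesis .
      qed
      finally show "norm ((1 + \<bar>y\<bar>) powr (- 1 - \<alpha>) * weighted v y)
          \<le> norm (C * (1 / (1 + \<bar>y\<bar>)\<^sup>2 + (v y)\<^sup>2))"
        using C(1) by (simp add: abs_mult power_divide mult_left_mono)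
    qed
  qed measurable
  then show ?thesis
    by (simp add: tail_integrable_def)
qed

lemma truncated_jump_eq:
  assumes [measurable]: "v \<in> borel_measurable borel"
  shows "truncated_jump \<alpha> \<sigma> v \<epsilon> x = truncated_op \<alpha> \<epsilon> (weighted v) x"
proof -
  have [measurable]: "\<sigma> \<in> borel_measurable borel"
    using coefficients_continuous(3) by (rule borel_measurable_continuous_onI)
  show ?thesis
    unfolding truncated_jump_def set_lebesgue_integral_def truncated_op_def truncated_kernel_def
    by (subst integral_stable_nu[OF \<alpha>]) (auto simp: mult_ac)
qed

text \<open>The compensator is odd in y even though it is cut off at |y| < 1 and not at |\<sigma> x
  y| < 1, so it cancels between y and -y. What remains is a second difference with step \<sigma> x
  y; substituting z = \<sigma> x y gives |\<sigma> x|^(1+\<alpha>) by homogeneity and loses one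
  power to the Jacobian.\<close>

lemma jump_integral_eq:
  assumes \<phi>: "\<phi> \<in> C2c"
  shows "(LINT y|stable_nu \<alpha>. jump_integrand \<sigma> \<phi> x y) = \<bar>\<sigma> x\<bar> powr \<alpha> * fractional_op \<alpha> \<phi> x"
proof -
  let ?k = "stable_kernel \<alpha>" and ?h = "jump_integrand \<sigma> \<phi> x"
  let ?F = "\<lambda>z. ?k z * second_difference \<phi> x z"
  have [measurable]: "\<phi> \<in> borel_measurable borel"
    by (rule C2c_D[OF \<phi>])
  have [measurable]: "?h \<in> borel_measurable borel"
    unfolding jump_integrand_def by measurable
  have "integrable (stable_nu \<alpha>) ?h"
    using dom \<phi> by (auto simp: generator_domain_def)
  then have "integrable lborel (\<lambda>y. ?k y * ?h y)"
    by (simp add: integrable_stable_nu[OF \<alpha>])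
  note sym = stable_kernel_symmetrize(2)[OF this]
  have "?k y * (?h y + ?h (- y)) = \<bar>\<sigma> x\<bar> powr (1 + \<alpha>) * ?F (0 + \<sigma> x * y)" for y
    using stable_kernel_scale[OF \<sigma>[of x], of \<alpha> y]
    by (simp add: jump_integrand_def second_difference_def indicator_def)
  then have "(LINT y|stable_nu \<alpha>. ?h y) = 1 / 2 * (\<bar>\<sigma> x\<bar> powr (1 + \<alpha>) * (LINT y|lborel. ?F (0 + \<sigma> x * y)))"
    by (simp add: integral_stable_nu[OF \<alpha>] sym)
  moreover have "(LINT z|lborel. ?F z) = \<bar>\<sigma> x\<bar> * (LINT y|lborel. ?F (0 + \<sigma> x * y))"
    using lborel_integral_real_affine[OF \<sigma>[of x], of ?F 0] by simp
  moreover have "\<bar>\<sigma> x\<bar> powr (1 + \<alpha>) = \<bar>\<sigma> x\<bar> * \<bar>\<sigma> x\<bar> powr \<alpha>"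
    using \<sigma>[of x] by (simp add: powr_add)
  ultimately show ?thesis
    by (simp add: fractional_op_def)
qed

lemma local_terms_integrable:
  assumes \<phi>: "\<phi> \<in> C2c" and v: "L2 v"
  shows "integrable lborel (\<lambda>x. deriv \<phi> x * (f x * v x))"
    and "integrable lborel (\<lambda>x. deriv (deriv \<phi>) x * ((g x)\<^sup>2 * v x))"
proof -
  obtain R where R: "vanishes_off R (deriv \<phi>)" "vanishes_off R (deriv (deriv \<phi>))"
    using C2c_vanishes_off[OF \<phi>] by metis
  note c = C2_D(4,5)[OF C2c_D(1)[OF \<phi>]] and l = L2_imp_loc_integrable[OF v]
  have "integrable lborel (\<lambda>x. (deriv \<phi> x * f x) * v x)"
    using R by (intro integrable_vanishes_off_mult[of _ R] continuous_intros c coefficients_continuous l)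
      (auto simp: vanishes_off_def)
  then show "integrable lborel (\<lambda>x. deriv \<phi> x * (f x * v x))"
    by (simp add: mult.assoc)
  have "integrable lborel (\<lambda>x. (deriv (deriv \<phi>) x * (g x)\<^sup>2) * v x)"
    using R by (intro integrable_vanishes_off_mult[of _ R] continuous_intros c coefficients_continuous l)
      (auto simp: vanishes_off_def)
  then show "integrable lborel (\<lambda>x. deriv (deriv \<phi>) x * ((g x)\<^sup>2 * v x))"
    by (simp add: mult.assoc)
qed

lemma generator_pairing:
  assumes \<phi>: "\<phi> \<in> C2c" and v: "L2 v"
  shows "(LINT x|lborel. generator \<alpha> f g \<sigma> \<phi> x * v x) =
    (LINT x|lborel. deriv \<phi> x * (f x * v x))
    + 1 / 2 * (LINT x|lborel. deriv (deriv \<phi>) x * ((g x)\<^sup>2 * v x))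
    + (LINT x|lborel. weighted v x * fractional_op \<alpha> \<phi> x)"
proof -
  have "generator \<alpha> f g \<sigma> \<phi> x * v x = deriv \<phi> x * (f x * v x)
      + 1 / 2 * (deriv (deriv \<phi>) x * ((g x)\<^sup>2 * v x)) + weighted v x * fractional_op \<alpha> \<phi> x" for x
    by (simp add: generator_def jump_integral_eq[OF \<phi>] algebra_simps)
  then show ?thesis
    using local_terms_integrable[OF assms]
      integrable_mult_fractional_op[OF \<alpha> \<phi> tail_integrable_weighted[OF v]]
    by simp
qed

lemma
  assumes \<phi>: "\<phi> \<in> C2c" and v: "L2 v" and \<epsilon>: "0 < \<epsilon>"
  shows integrable_mult_truncated_jump: "integrable lborel (\<lambda>x. \<phi> x * truncated_jump \<alpha> \<sigma> v \<epsilon> x)"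
    and truncated_jump_pairing: "(LINT x|lborel. \<phi> x * truncated_jump \<alpha> \<sigma> v \<epsilon> x)
      = (LINT x|lborel. weighted v x * truncated_op \<alpha> \<epsilon> \<phi> x)"
proof -
  obtain R where R: "1 \<le> R" "vanishes_off R \<phi>"
    using C2c_vanishes_off[OF \<phi>] by metis
  obtain M where M: "\<And>x. \<bar>\<phi> x\<bar> \<le> M"
    using continuous_vanishes_off_bounded[OF C2c_D(2)[OF \<phi>] R(2)] by metis
  have R0: "0 \<le> R" using R by simp
  note hyps = C2c_D(3)[OF \<phi>] M R(2) R0 tail_integrable_weighted[OF v] \<epsilon>
  show "integrable lborel (\<lambda>x. \<phi> x * truncated_jump \<alpha> \<sigma> v \<epsilon> x)"
    unfolding truncated_jump_eq[OF L2_imp_borel[OF v]] by (rule integrable_mult_truncated_op[OF \<alpha> hyps])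
  show "(LINT x|lborel. \<phi> x * truncated_jump \<alpha> \<sigma> v \<epsilon> x)
      = (LINT x|lborel. weighted v x * truncated_op \<alpha> \<epsilon> \<phi> x)"
    unfolding truncated_jump_eq[OF L2_imp_borel[OF v]] by (rule truncated_op_symmetric[OF \<alpha> hyps])
qed

text \<open>Only the jump term depends on \<epsilon>. By symmetry it can be read as a truncated
  operator acting on \<phi>, where the smoothness of \<phi> provides the limit although v is merely
  square integrable.\<close>

lemma weak_pairing_tendsto:
  assumes \<phi>: "\<phi> \<in> C2c" and v: "L2 v"
  shows "((\<lambda>\<epsilon>. (LINT x|lborel. deriv \<phi> x * (f x * v x))
              + 1 / 2 * (LINT x|lborel. deriv (deriv \<phi>) x * ((g x)\<^sup>2 * v x))
              + (LINT x|lborel. \<phi> x * truncated_jump \<alpha> \<sigma> v \<epsilon> x))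
           \<longlongrightarrow> (LINT x|lborel. generator \<alpha> f g \<sigma> \<phi> x * v x)) (at_right 0)"
  unfolding generator_pairing[OF assms]
proof (intro tendsto_add tendsto_const)
  have "\<forall>\<^sub>F \<epsilon> in at_right 0. (LINT x|lborel. weighted v x * truncated_op \<alpha> \<epsilon> \<phi> x)
      = (LINT x|lborel. \<phi> x * truncated_jump \<alpha> \<sigma> v \<epsilon> x)"
    using eventually_at_right_less[of "0::real"]
    by eventually_elim (simp add: truncated_jump_pairing[OF assms])
  with tendsto_integral_truncated_op[OF \<alpha> \<phi> tail_integrable_weighted[OF v]]
  show "((\<lambda>\<epsilon>. LINT x|lborel. \<phi> x * truncated_jump \<alpha> \<sigma> v \<epsilon> x)
      \<longlongrightarrow> (LINT x|lborel. weighted v x * fractional_op \<alpha> \<phi> x)) (at_right 0)"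
    by (rule Lim_transform_eventually)
qed

text \<open>The limit in the weak formula always exists and is the left-hand side of the adjoint
  relation, so by uniqueness of limits both conditions say the same about w.\<close>

lemma fp_weak_iff_L2_adjoint: "fp_weak \<alpha> f g \<sigma> v w \<longleftrightarrow> L2_adjoint C2c (generator \<alpha> f g \<sigma>) v w"
proof (cases "L2 v")
  case True
  have iff: "(F \<longlongrightarrow> l) (at_right 0) \<longleftrightarrow> k = l" if "(F \<longlongrightarrow> k) (at_right 0)"
    for F :: "real \<Rightarrow> real" and k l
    using that tendsto_unique[OF trivial_limit_at_right_real] by blast
  show ?thesis
    unfolding fp_weak_def L2_adjoint_def
    by (intro conj_cong refl ball_cong iff weak_pairing_tendsto True)
qed (simp add: fp_weak_def L2_adjoint_def)

section \<open>Classical formula for regular functions\<close>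

context
  fixes v :: "real \<Rightarrow> real"
  assumes reg: "fp_regular \<alpha> f g \<sigma> v"
begin

lemma regular_L2: "L2 v"
  using reg by (simp add: fp_regular_def)

lemma regular_C1_C2: "(\<lambda>x. f x * v x) C1_differentiable_on UNIV" "C2 (\<lambda>x. (g x)\<^sup>2 * v x)"
  using reg by (auto simp: fp_regular_def)

lemma regular_uniform_limit:
  "compact K \<Longrightarrow> uniform_limit K (truncated_jump \<alpha> \<sigma> v) (pv_jump \<alpha> \<sigma> v) (at_right 0)"
  using reg by (auto simp: fp_regular_def)

lemma truncated_jump_measurable: "truncated_jump \<alpha> \<sigma> v \<epsilon> \<in> borel_measurable borel"
proof -
  have [measurable]: "\<sigma> \<in> borel_measurable borel"
    using coefficients_continuous(3) by (rule borel_measurable_continuous_onI)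
  have [measurable]: "v \<in> borel_measurable borel"
    by (rule L2_imp_borel[OF regular_L2])
  show ?thesis
    unfolding truncated_jump_eq[OF L2_imp_borel[OF regular_L2], abs_def] truncated_op_def by measurable
qed

lemma pv_jump_measurable: "pv_jump \<alpha> \<sigma> v \<in> borel_measurable borel"
proof (rule borel_measurable_LIMSEQ_real)
  show "truncated_jump \<alpha> \<sigma> v (inverse (real (Suc n))) \<in> borel_measurable borel" for n
    by (rule truncated_jump_measurable)
  have lim: "filterlim (\<lambda>n. inverse (real (Suc n))) (at_right 0) sequentially"
    unfolding filterlim_at using LIMSEQ_inverse_real_of_nat by (simp del: of_nat_Suc)
  \<comment> \<open>Applied to the compact set {x}, the uniform limit guarantees that the
    \<open>Lim\<close> in \<open>pv_jump\<close> is a genuine limit and not a default value.\<close>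
  show "(\<lambda>n. truncated_jump \<alpha> \<sigma> v (inverse (real (Suc n))) x) \<longlonglongrightarrow> pv_jump \<alpha> \<sigma> v x" for x
    using filterlim_compose[OF tendsto_uniform_limitI[OF regular_uniform_limit[of "{x}"]] lim, of x]
    by simp
qed

text \<open>By uniform convergence the principal value is within distance 1 of a single truncated
  operator on [-R, R], and the latter is locally integrable.\<close>

lemma pv_jump_loc_integrable: "loc_integrable (pv_jump \<alpha> \<sigma> v)"
  unfolding loc_integrable_def
proof
  fix R :: real
  have "\<forall>\<^sub>F \<epsilon> in at_right 0. 0 < \<epsilon> \<and> (\<forall>x\<in>{- R..R}. dist (truncated_jump \<alpha> \<sigma> v \<epsilon> x) (pv_jump \<alpha> \<sigma> v x) < 1)"
    using uniform_limitD[OF regular_uniform_limit[of "{- R..R}"]]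
    by (intro eventually_conj eventually_at_right_less) auto
  then obtain \<epsilon> where \<epsilon>: "0 < \<epsilon>"
    and close: "\<And>x. x \<in> {- R..R} \<Longrightarrow> dist (truncated_jump \<alpha> \<sigma> v \<epsilon> x) (pv_jump \<alpha> \<sigma> v x) < 1"
    using eventually_happens'[OF trivial_limit_at_right_real] by blast
  \<comment> \<open>The indicator of the interval plays the part of the bounded test function; |R|
    is a valid support radius also for negative R.\<close>
  have "integrable lborel (\<lambda>x. indicator {- R..R} x * truncated_op \<alpha> \<epsilon> (weighted v) x)"
    by (rule integrable_mult_truncated_op[OF \<alpha>, where M = 1 and R = "\<bar>R\<bar>"])
       (auto simp: vanishes_off_def tail_integrable_weighted[OF regular_L2] \<epsilon> indicator_def)
  then have T: "integrable lborel (\<lambda>x. indicator {- R..R} x * truncated_jump \<alpha> \<sigma> v \<epsilon> x)"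
    by (simp add: truncated_jump_eq[OF L2_imp_borel[OF regular_L2]])
  have "integrable lborel (\<lambda>x. \<bar>indicator {- R..R} x * truncated_jump \<alpha> \<sigma> v \<epsilon> x\<bar> + indicator {- R..R} x)"
    by (intro Bochner_Integration.integrable_add integrable_abs T integrable_real_indicator
        emeasure_bounded_finite) auto
  then show "integrable lborel (\<lambda>x. indicator {- R..R} x * pv_jump \<alpha> \<sigma> v x)"
  proof (rule Bochner_Integration.integrable_bound)
    show "(\<lambda>x. indicator {- R..R} x * pv_jump \<alpha> \<sigma> v x) \<in> borel_measurable lborel"
      using pv_jump_measurable by simp
    show "AE x in lborel. norm (indicator {- R..R} x * pv_jump \<alpha> \<sigma> v x)
        \<le> norm (\<bar>indicator {- R..R} x * truncated_jump \<alpha> \<sigma> v \<epsilon> x\<bar> + indicator {- R..R} x)"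
    proof (intro AE_I2)
      fix x
      show "norm (indicator {- R..R} x * pv_jump \<alpha> \<sigma> v x)
          \<le> norm (\<bar>indicator {- R..R} x * truncated_jump \<alpha> \<sigma> v \<epsilon> x\<bar> + indicator {- R..R} x)"
        using close[of x] by (cases "x \<in> {- R..R}") (simp_all add: dist_real_def)
    qed
  qed
qed

text \<open>The error is at most the L^1 norm of \<phi> times the supremum, over a compact set
  containing the support of \<phi>, of the distance to the limit.\<close>

lemma pv_jump_pairing_tendsto:
  assumes \<phi>: "\<phi> \<in> C2c"
  shows "((\<lambda>\<epsilon>. LINT x|lborel. \<phi> x * truncated_jump \<alpha> \<sigma> v \<epsilon> x)
    \<longlongrightarrow> (LINT x|lborel. \<phi> x * pv_jump \<alpha> \<sigma> v x)) (at_right 0)"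
proof (rule tendstoI)
  fix e :: real assume "0 < e"
  obtain R where R: "vanishes_off R \<phi>"
    using C2c_vanishes_off[OF \<phi>] by metis
  have \<phi>int: "integrable lborel (\<lambda>x. \<bar>\<phi> x\<bar>)"
    using integrable_abs[OF C2c_D(4)[OF \<phi> loc_integrable_continuous[of "\<lambda>_. 1"]]] by simp
  define K where "K = (LINT x|lborel. \<bar>\<phi> x\<bar>)"
  have K: "0 \<le> K"
    by (simp add: K_def)
  \<comment> \<open>K + 1 avoids a division by zero when \<phi> vanishes almost everywhere.\<close>
  define d where "d = e / (K + 1)"
  have d: "0 < d" "K * d < e"
    using \<open>0 < e\<close> K by (auto simp: d_def field_simps)
  have "\<forall>\<^sub>F \<epsilon> in at_right 0. 0 < \<epsilon> \<and> (\<forall>x\<in>{- R..R}. dist (truncated_jump \<alpha> \<sigma> v \<epsilon> x) (pv_jump \<alpha> \<sigma> v x) < d)"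
    using uniform_limitD[OF regular_uniform_limit[of "{- R..R}"] d(1)]
    by (intro eventually_conj eventually_at_right_less) auto
  then show "\<forall>\<^sub>F \<epsilon> in at_right 0. dist (LINT x|lborel. \<phi> x * truncated_jump \<alpha> \<sigma> v \<epsilon> x)
      (LINT x|lborel. \<phi> x * pv_jump \<alpha> \<sigma> v x) < e"
  proof eventually_elim
    case (elim \<epsilon>)
    let ?D = "\<lambda>x. \<phi> x * truncated_jump \<alpha> \<sigma> v \<epsilon> x - \<phi> x * pv_jump \<alpha> \<sigma> v x"
    have T: "integrable lborel (\<lambda>x. \<phi> x * truncated_jump \<alpha> \<sigma> v \<epsilon> x)"
      using elim by (intro integrable_mult_truncated_jump[OF \<phi> regular_L2]) auto
    have P: "integrable lborel (\<lambda>x. \<phi> x * pv_jump \<alpha> \<sigma> v x)"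
      by (rule C2c_D(4)[OF \<phi> pv_jump_loc_integrable])
    have le: "\<bar>?D x\<bar> \<le> \<bar>\<phi> x\<bar> * d" for x
    proof (cases "R < \<bar>x\<bar>")
      case False
      then have "x \<in> {- R..R}"
        by (simp add: abs_le_iff not_less)
      then have "\<bar>truncated_jump \<alpha> \<sigma> v \<epsilon> x - pv_jump \<alpha> \<sigma> v x\<bar> \<le> d"
        using elim by (simp add: dist_real_def less_imp_le)
      then show ?thesis
        by (simp add: abs_mult mult_left_mono flip: right_diff_distrib)
    qed (use R in \<open>simp add: vanishes_off_def\<close>)
    have "dist (LINT x|lborel. \<phi> x * truncated_jump \<alpha> \<sigma> v \<epsilon> x) (LINT x|lborel. \<phi> x * pv_jump \<alpha> \<sigma> v x)
        = \<bar>LINT x|lborel. ?D x\<bar>"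
      using T P by (simp add: dist_real_def)
    also have "\<dots> \<le> (LINT x|lborel. \<bar>?D x\<bar>)"
      using integral_norm_bound[of lborel ?D] by simp
    also have "\<dots> \<le> (LINT x|lborel. \<bar>\<phi> x\<bar> * d)"
      using T P le \<phi>int by (intro integral_mono integrable_abs) auto
    also have "\<dots> < e"
      using d by (simp add: K_def)
    finally show ?case .
  qed
qed

lemma fp_operator_measurable: "fp_operator \<alpha> f g \<sigma> v \<in> borel_measurable borel"
  and fp_operator_loc_integrable: "loc_integrable (fp_operator \<alpha> f g \<sigma> v)"
proof -
  let ?E = "\<lambda>x. - deriv (\<lambda>x. f x * v x) x + 1 / 2 * deriv (deriv (\<lambda>x. (g x)\<^sup>2 * v x)) x"
  have E: "continuous_on UNIV ?E"
    by (intro continuous_intros C1_differentiable_on_UNIV_D regular_C1_C2 C2_D)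
  show "fp_operator \<alpha> f g \<sigma> v \<in> borel_measurable borel"
    unfolding fp_operator_def[abs_def]
    by (intro borel_measurable_add[of ?E] borel_measurable_continuous_onI[OF E] pv_jump_measurable)
  show "loc_integrable (fp_operator \<alpha> f g \<sigma> v)"
    unfolding fp_operator_def[abs_def]
    by (intro loc_integrable_add[of ?E] loc_integrable_continuous[OF E] pv_jump_loc_integrable)
qed

text \<open>The weak expression has two limits: the pairing with the generator, and, after
  integration by parts, the pairing with the classical formula. Derivatives fall on the products f v
  and g^2 v, the only smoothness that regularity provides.\<close>

lemma fp_operator_pairing:
  assumes \<phi>: "\<phi> \<in> C2c"
  shows "(LINT x|lborel. generator \<alpha> f g \<sigma> \<phi> x * v x) = (LINT x|lborel. \<phi> x * fp_operator \<alpha> f g \<sigma> v x)"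
proof -
  obtain R where R: "vanishes_off R \<phi>" "vanishes_off R (deriv \<phi>)" "vanishes_off R (deriv (deriv \<phi>))"
    using C2c_vanishes_off[OF \<phi>] by metis
  note d = C2_D[OF C2c_D(1)[OF \<phi>]] and F = C1_differentiable_on_UNIV_D[OF regular_C1_C2(1)]
    and G = C2_D[OF regular_C1_C2(2)]
  let ?F' = "deriv (\<lambda>x. f x * v x)" and ?G' = "deriv (\<lambda>x. (g x)\<^sup>2 * v x)"
  have 1: "(LINT x|lborel. deriv \<phi> x * (f x * v x)) = - (LINT x|lborel. \<phi> x * ?F' x)"
    by (rule integral_by_parts_vanishes_off[OF d(1,4) F R(1,2)])
  have "(LINT x|lborel. deriv (deriv \<phi>) x * ((g x)\<^sup>2 * v x)) = - (LINT x|lborel. deriv \<phi> x * ?G' x)"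
    by (rule integral_by_parts_vanishes_off[OF d(2,5) G(1,4) R(2,3)])
  also have "\<dots> = (LINT x|lborel. \<phi> x * deriv ?G' x)"
    using integral_by_parts_vanishes_off[OF d(1,4) G(2,5) R(1,2)] by simp
  finally have 2: "(LINT x|lborel. deriv (deriv \<phi>) x * ((g x)\<^sup>2 * v x)) = (LINT x|lborel. \<phi> x * deriv ?G' x)" .
  have "(LINT x|lborel. generator \<alpha> f g \<sigma> \<phi> x * v x) = - (LINT x|lborel. \<phi> x * ?F' x)
      + 1 / 2 * (LINT x|lborel. \<phi> x * deriv ?G' x) + (LINT x|lborel. \<phi> x * pv_jump \<alpha> \<sigma> v x)"
    using weak_pairing_tendsto[OF \<phi> regular_L2] unfolding 1 2
    by (rule tendsto_unique[OF trivial_limit_at_right_real])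
       (intro tendsto_intros pv_jump_pairing_tendsto \<phi>)
  also have "\<dots> = (LINT x|lborel. \<phi> x * fp_operator \<alpha> f g \<sigma> v x)"
  proof -
    have "integrable lborel (\<lambda>x. \<phi> x * ?F' x)" "integrable lborel (\<lambda>x. \<phi> x * deriv ?G' x)"
      "integrable lborel (\<lambda>x. \<phi> x * pv_jump \<alpha> \<sigma> v x)"
      by (auto intro!: C2c_D(4)[OF \<phi>] loc_integrable_continuous F(2) G(5) pv_jump_loc_integrable)
    moreover have "\<phi> x * fp_operator \<alpha> f g \<sigma> v x
        = - (\<phi> x * ?F' x) + 1 / 2 * (\<phi> x * deriv ?G' x) + \<phi> x * pv_jump \<alpha> \<sigma> v x" for x
      by (simp add: fp_operator_def algebra_simps)
    ultimately show ?thesis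
      by simp
  qed
  finally show ?thesis .
qed

text \<open>An image under the adjoint is known only through its integrals against test functions;
  the fundamental lemma, applicable because the classical expression is locally integrable, upgrades
  this to equality almost everywhere.\<close>

lemma fp_classical_iff_L2_adjoint: "fp_classical \<alpha> f g \<sigma> v w \<longleftrightarrow> L2_adjoint C2c (generator \<alpha> f g \<sigma>) v w"
proof
  assume *: "fp_classical \<alpha> f g \<sigma> v w"
  then have w: "L2 w" and eq: "AE x in lborel. w x = fp_operator \<alpha> f g \<sigma> v x"
    by (auto simp: fp_classical_def)
  have "(LINT x|lborel. \<phi> x * fp_operator \<alpha> f g \<sigma> v x) = (LINT x|lborel. \<phi> x * w x)" if "\<phi> \<in> C2c" for \<phi>
    using C2c_D(3)[OF that] L2_imp_borel[OF w] fp_operator_measurable eq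
    by (intro integral_cong_AE) auto
  with w regular_L2 show "L2_adjoint C2c (generator \<alpha> f g \<sigma>) v w"
    by (simp add: L2_adjoint_def fp_operator_pairing)
next
  assume *: "L2_adjoint C2c (generator \<alpha> f g \<sigma>) v w"
  then have w: "L2 w"
    by (simp add: L2_adjoint_def)
  have "AE x in lborel. w x = fp_operator \<alpha> f g \<sigma> v x"
    using * by (intro AE_eq_of_test_integrals L2_imp_borel w fp_operator_measurable L2_imp_loc_integrable
      fp_operator_loc_integrable) (auto simp: L2_adjoint_def fp_operator_pairing)
  with w regular_L2 show "fp_classical \<alpha> f g \<sigma> v w"
    by (simp add: fp_classical_def)
qed

text \<open>Up to null sets the only candidate for the image is the classical expression, so
  membership reduces to its square integrability.\<close>

lemma L2_adjoint_dom_iff: "v \<in> L2_adjoint_dom C2c (generator \<alpha> f g \<sigma>) \<longleftrightarrow> L2 (fp_operator \<alpha> f g \<sigma> v)"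
proof
  assume "v \<in> L2_adjoint_dom C2c (generator \<alpha> f g \<sigma>)"
  then obtain w where w: "L2 w" "AE x in lborel. w x = fp_operator \<alpha> f g \<sigma> v x"
    by (auto simp: L2_adjoint_dom_def fp_classical_def simp flip: fp_classical_iff_L2_adjoint)
  have "integrable lborel (\<lambda>x. (fp_operator \<alpha> f g \<sigma> v x)\<^sup>2)"
    using w fp_operator_measurable
    by (subst integrable_cong_AE[of _ _ "\<lambda>x. (w x)\<^sup>2"]) (auto simp: L2_def)
  then show "L2 (fp_operator \<alpha> f g \<sigma> v)"
    using fp_operator_measurable by (simp add: L2_def)
next
  assume "L2 (fp_operator \<alpha> f g \<sigma> v)"
  then have "fp_classical \<alpha> f g \<sigma> v (fp_operator \<alpha> f g \<sigma> v)"
    by (simp add: fp_classical_def regular_L2)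
  then show "v \<in> L2_adjoint_dom C2c (generator \<alpha> f g \<sigma>)"
    by (auto simp: L2_adjoint_dom_def fp_classical_iff_L2_adjoint)
qed

end

end

section \<open>Passage to larger domains and to the evolution equation\<close>

text \<open>Test functions determine the image, so on the domain of the adjoint of the larger operator
  the two adjoints agree, although the domain for \<open>C2c\<close> may be larger.\<close>

lemma L2_adjoint_iff_C2c:
  assumes D: "C2c \<subseteq> D" "\<And>\<phi>. \<phi> \<in> D \<Longrightarrow> L2 \<phi>" and v: "v \<in> L2_adjoint_dom D A"
  shows "L2_adjoint D A v w \<longleftrightarrow> L2_adjoint C2c A v w"
proof
  assume "L2_adjoint D A v w"
  with D(1) show "L2_adjoint C2c A v w"
    by (auto simp: L2_adjoint_def)
next
  assume w: "L2_adjoint C2c A v w"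
  obtain w' where w': "L2_adjoint D A v w'"
    using v by (auto simp: L2_adjoint_dom_def)
  have L2s: "L2 w" "L2 w'"
    using w w' by (auto simp: L2_adjoint_def)
  have "(LINT x|lborel. \<phi> x * w x) = (LINT x|lborel. \<phi> x * w' x)" if "\<phi> \<in> C2c" for \<phi>
  proof -
    have "(LINT x|lborel. A \<phi> x * v x) = (LINT x|lborel. \<phi> x * w x)"
      using w that by (simp add: L2_adjoint_def)
    moreover have "(LINT x|lborel. A \<phi> x * v x) = (LINT x|lborel. \<phi> x * w' x)"
      using w' that D(1) by (auto simp: L2_adjoint_def)
    ultimately show ?thesis by simp
  qed
  then have eq: "AE x in lborel. w x = w' x"
    by (intro AE_eq_of_test_integrals L2_imp_borel L2_imp_loc_integrable L2s)
  have "(LINT x|lborel. \<phi> x * w' x) = (LINT x|lborel. \<phi> x * w x)" if "\<phi> \<in> D" for \<phi>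
    using L2_imp_borel[OF D(2)[OF that]] L2s[THEN L2_imp_borel] eq
    by (intro integral_cong_AE) auto
  with w w' show "L2_adjoint D A v w"
    by (simp add: L2_adjoint_def)
qed

text \<open>The graph is consulted only at the slices with t > 0, and the initial condition does not
  involve it.\<close>

lemma evolution_problem_cong:
  assumes "\<And>t q. 0 < t \<Longrightarrow> G (\<lambda>x. p x t) q \<longleftrightarrow> H (\<lambda>x. p x t) q"
  shows "evolution_problem G x0 p \<longleftrightarrow> evolution_problem H x0 p"
  using assms by (simp add: evolution_problem_def)

theorem theorem1:
  fixes \<alpha> x0 :: real and f g \<sigma> :: "real \<Rightarrow> real"
    and D :: "(real \<Rightarrow> real) set"
  assumes alpha: "0 < \<alpha>" "\<alpha> < 2"
    and H1: "\<exists>\<gamma>>0. \<forall>x1 x2.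
        \<bar>f x1 - f x2\<bar>\<^sup>2 + \<bar>g x1 - g x2\<bar>\<^sup>2
        + (LINT y:{y. \<bar>y\<bar> < 1}|stable_nu \<alpha>. \<bar>\<sigma> x1 * y - \<sigma> x2 * y\<bar>\<^sup>2)
        \<le> \<gamma> * \<bar>x1 - x2\<bar>\<^sup>2"
    and H2: "\<exists>K>0. \<forall>x.
        2 * x * f x + \<bar>g x\<bar>\<^sup>2 + (LINT y:{y. \<bar>y\<bar> < 1}|stable_nu \<alpha>. \<bar>\<sigma> x * y\<bar>\<^sup>2)
        \<le> K * (1 + x\<^sup>2)"
    and H3: "(\<lambda>x. \<bar>\<sigma> x\<bar> powr \<alpha>) C1_differentiable_on UNIV" "\<forall>x. \<sigma> x \<noteq> 0"
    and D: "generator_domain \<alpha> f g \<sigma> D"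
  shows
    "generator_domain \<alpha> f g \<sigma> C2c \<and>
     (\<forall>v \<in> L2_adjoint_dom D (generator \<alpha> f g \<sigma>). \<forall>w.
        (L2_adjoint D (generator \<alpha> f g \<sigma>) v w \<longleftrightarrow> fp_weak \<alpha> f g \<sigma> v w) \<and>
        (fp_regular \<alpha> f g \<sigma> v \<longrightarrow>
           (L2_adjoint D (generator \<alpha> f g \<sigma>) v w \<longleftrightarrow> fp_classical \<alpha> f g \<sigma> v w))) \<and>
     (\<forall>v. (v \<in> L2_adjoint_dom C2c (generator \<alpha> f g \<sigma>) \<longleftrightarrow> (\<exists>w. fp_weak \<alpha> f g \<sigma> v w)) \<and>
          (fp_regular \<alpha> f g \<sigma> v \<longrightarrow>
             (v \<in> L2_adjoint_dom C2c (generator \<alpha> f g \<sigma>) \<longleftrightarrow> L2 (fp_operator \<alpha> f g \<sigma> v)))) \<and>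
     (\<forall>p. (\<forall>t>0. (\<lambda>x. p x t) \<in> L2_adjoint_dom D (generator \<alpha> f g \<sigma>)) \<longrightarrow>
        (evolution_problem (L2_adjoint D (generator \<alpha> f g \<sigma>)) x0 p \<longleftrightarrow>
         evolution_problem (fp_weak \<alpha> f g \<sigma>) x0 p) \<and>
        ((\<forall>t>0. fp_regular \<alpha> f g \<sigma> (\<lambda>x. p x t)) \<longrightarrow>
          (evolution_problem (L2_adjoint D (generator \<alpha> f g \<sigma>)) x0 p \<longleftrightarrow>
           evolution_problem (fp_classical \<alpha> f g \<sigma>) x0 p)))"
proof -
  let ?A = "generator \<alpha> f g \<sigma>"
  have sub: "C2c \<subseteq> D" and L2D: "\<And>\<phi>. \<phi> \<in> D \<Longrightarrow> L2 \<phi>"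
    using D by (auto simp: generator_domain_def)
  \<comment> \<open>The conditions on D are quantified over its elements, so they are inherited by
    the test functions it contains.\<close>
  have dom: "generator_domain \<alpha> f g \<sigma> C2c"
    using D by (auto simp: generator_domain_def)
  have nz: "\<And>x. \<sigma> x \<noteq> 0"
    using H3 by simp
  note hyps = alpha H1 nz dom
  note weak = fp_weak_iff_L2_adjoint[OF hyps] and classical = fp_classical_iff_L2_adjoint[OF hyps]
    and dom_iff = L2_adjoint_dom_iff[OF hyps] and adj = L2_adjoint_iff_C2c[OF sub L2D]
  have D_weak: "L2_adjoint D ?A v w \<longleftrightarrow> fp_weak \<alpha> f g \<sigma> v w"
    if "v \<in> L2_adjoint_dom D ?A" for v w
    using adj[OF _ that] by (simp add: weak)
  have D_classical: "L2_adjoint D ?A v w \<longleftrightarrow> fp_classical \<alpha> f g \<sigma> v w"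
    if "v \<in> L2_adjoint_dom D ?A" "fp_regular \<alpha> f g \<sigma> v" for v w
    using adj[OF _ that(1)] by (simp add: classical[OF that(2)])
  have C2c_weak: "v \<in> L2_adjoint_dom C2c ?A \<longleftrightarrow> (\<exists>w. fp_weak \<alpha> f g \<sigma> v w)" for v
    by (simp add: L2_adjoint_dom_def weak)
  show ?thesis
  proof (intro conjI allI ballI impI)
    fix p :: "real \<Rightarrow> real \<Rightarrow> real"
    assume p: "\<forall>t>0. (\<lambda>x. p x t) \<in> L2_adjoint_dom D ?A"
    then show "evolution_problem (L2_adjoint D ?A) x0 p \<longleftrightarrow> evolution_problem (fp_weak \<alpha> f g \<sigma>) x0 p"
      by (intro evolution_problem_cong D_weak) simp
    assume "\<forall>t>0. fp_regular \<alpha> f g \<sigma> (\<lambda>x. p x t)"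
    with p show "evolution_problem (L2_adjoint D ?A) x0 p \<longleftrightarrow> evolution_problem (fp_classical \<alpha> f g \<sigma>) x0 p"
      by (intro evolution_problem_cong D_classical) simp_all
  qed (rule dom D_weak D_classical C2c_weak dom_iff; assumption)+
qed

end
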